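(* (a) The BCS state $\Psi_{BCS}$ is the ground state of $H_M$, and the ground state energy $E_{BCS}$ is given by $$E_{BCS}=\sum_{k\in\Lambda}\left\{\xi_k-\sqrt{\xi_k^2+\Delta_k^2}+\Delta_k\left(\Psi_{BCS},C_{-k\downarrow}C_{k\uparrow}\Psi_{BCS}\right)\right\}.$$ (b) With this $E_{BCS}$, the spectrum of $H_M$ is $$\sigma(H_M)=\left\{\sum_{k\in\Lambda}\sqrt{\xi_k^2+\Delta_k^2}\,(N_{k\uparrow}+N_{k\downarrow})+E_{BCS}\ :\ N_{k\uparrow},N_{k\downarrow}\in\{0,1\}\ (k\in\Lambda)\right\}.$$
   Context: Fix (large) real numbers $L,K_{max}>0$ and let $\Lambda=\{\frac{2\pi}{L}(n_1,n_2,n_3)\in\mathbb{R}^3: n_1,n_2,n_3\in\mathbb{Z},\ \frac{2\pi}{L}\sqrt{n_1^2+n_2^2+n_3^2}\le K_{max}\}$, a finite set with $M$ elements, whose elements are arranged in a fixed order. Let $\mathcal{H}=\mathbb{C}^{2^{2M}}$ with its standard inner product $(\cdot,\cdot)$; its standard unit vectors are labelled $|n_{k\uparrow},n_{k\downarrow},n_{k'\uparrow},n_{k'\downarrow},\ldots\rangle$ with $n_{k\sigma}\in\{0,1\}$, $k\in\Lambda$, $\sigma\in\{\uparrow,\downarrow\}$, and $|0\rangle$ denotes the one with all $n_{k\sigma}=0$. The annihilation operator $C_{k\sigma}$ is the linear operator on $\mathcal{H}$ which sends a standard unit vector with $n_{k\sigma}=1$ to $(-1)^{s}$ times the standard unit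 vector obtained by replacing $n_{k\sigma}$ by $0$, where $s$ is the sum of the occupation numbers to the left of $n_{k\sigma}$, and sends a standard unit vector with $n_{k\sigma}=0$ to $0$. The creation operator $C_{k\sigma}^*$ sends a standard unit vector with $n_{k\sigma}=0$ to $(-1)^{s}$ times the one with $n_{k\sigma}$ replaced by $1$ (same $s$), and one with $n_{k\sigma}=1$ to $0$; it is the adjoint of $C_{k\sigma}$. Let $m,\mu,\hbar>0$ and $\xi_k=\hbar^2|k|^2/(2m)-\mu$. Let $U_{k,k'}$ ($k,k'\in\Lambda$) be real with $U_{k,k'}\le 0$, $U_{k',k}=U_{k,k'}$, $U_{-k,-k'}=U_{k,k'}$, $U_{k,k}=0$. It is assumed that there is a function $\Delta_k\ge0$ of $k\in\Lambda$ with $\Delta_{-k}=\Delta_k$ and $\xi_k^2+\Delta_k^2>0$ for all $k$, solving the gap equation $\Delta_k=-\frac12\sum_{k'\in\Lambda}U_{k,k'}\Delta_{k'}/\sqrt{\xi_{k'}^2+\Delta_{k'}^2}$; fix such a $\Delta$. Let $\theta_k\in[0,\pi/2]$ be defined by $\sin2\theta_k=\Delta_k/\sqrt{\xi_k^2+\Delta_k^2}$, $\cos2\theta_k=\xi_k/\sqrt{\xi_k^2+\Delta_k^2}$. Let $G_B=i\sum_{k\in\Lambda}\theta_k(C_{-k\downarrow}C_{k\uparrow}-C_{k\uparrow}^*C_{-k\downarrow}^* )$. The BCS state is $\Psi_{BCS}=e^{iG_B}|0\rangle$. The mean field Hamiltonian is $$H_M=\sum_{k\in\Lambda,\,\sigma=\uparrow,\downarrow}\xi_kC_{k\sigma}^*C_{k\sigma}-\sum_{k\in\Lambda}\Delta_k\left(C_{-k\downarrow}C_{k\uparrow}+C_{k\uparrow}^*C_{-k\downarrow}^*\right)+\sum_{k\in\Lambda}\Delta_k\left(\Psi_{BCS},C_{-k\downarrow}C_{k\uparrow}\Psi_{BCS}\right).$$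 A ground state of a selfadjoint operator on $\mathcal{H}$ is a unit eigenvector belonging to its smallest eigenvalue, and this eigenvalue is the ground state energy. *)

theory Defs
  imports
    "HOL-Analysis.Analysis"
    "Jordan_Normal_Form.Spectral_Radius"
    "Jordan_Normal_Form.Schur_Decomposition"
begin

hide_const (open) Finite_Cartesian_Product.mat Finite_Cartesian_Product.vec

definition momenta :: "real \<Rightarrow> real \<Rightarrow> (real ^ 3) set" where
  "momenta L Kmax =
     {(2 * pi / L) *\<^sub>R vector [of_int n1, of_int n2, of_int n3] | n1 n2 n3 :: int.
        (2 * pi / L) * sqrt ((of_int n1)\<^sup>2 + (of_int n2)\<^sup>2 + (of_int n3)\<^sup>2) \<le> Kmax}"

datatype spin = Up | Down

text \<open>The fixed arrangement of the momenta is a map \<open>pos\<close> that numbers the elements of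
  \<open>\<Lambda>\<close> by \<open>0, \<dots>, card \<Lambda> - 1\<close>; the occupation numbers are then listed in the order
  \<open>k\<up>, k\<down>, k'\<up>, k'\<down>, \<dots>\<close>.\<close>

fun mode_pos :: "(real ^ 3 \<Rightarrow> nat) \<Rightarrow> real ^ 3 \<Rightarrow> spin \<Rightarrow> nat" where
  "mode_pos pos k Up = 2 * pos k"
| "mode_pos pos k Down = 2 * pos k + 1"

text \<open>The space is \<open>carrier_vec (dimH \<Lambda>)\<close>. The standard unit vector with occupation numbers
  \<open>n\<^sub>0, n\<^sub>1, \<dots>\<close> (from left to right) is \<open>unit_vec (dimH \<Lambda>) j\<close> with \<open>j = (\<Sum>q. n\<^sub>q * 2 ^ q)\<close>,
  so that \<open>bit j q\<close> says that the \<open>q\<close>-th occupation number is 1, and \<open>j = 0\<close> is the vacuum.\<close>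

definition dimH :: "(real ^ 3) set \<Rightarrow> nat" where
  "dimH \<Lambda> = 2 ^ (2 * card \<Lambda>)"

definition vacuum :: "(real ^ 3) set \<Rightarrow> complex Matrix.vec" where
  "vacuum \<Lambda> = unit_vec (dimH \<Lambda>) 0"

definition occ_left :: "nat \<Rightarrow> nat \<Rightarrow> nat" where
  "occ_left p j = (\<Sum>q<p. of_bool (bit j q))"

text \<open>Column \<open>j\<close> of the matrix is the image of the standard unit vector \<open>j\<close>.\<close>

definition annih ::
  "(real ^ 3) set \<Rightarrow> (real ^ 3 \<Rightarrow> nat) \<Rightarrow> real ^ 3 \<Rightarrow> spin \<Rightarrow> complex Matrix.mat" where
  "annih \<Lambda> pos k s = (let p = mode_pos pos k s in
     Matrix.mat (dimH \<Lambda>) (dimH \<Lambda>) (\<lambda>(i, j).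
       if bit j p \<and> i = unset_bit p j then (- 1) ^ occ_left p j else 0))"

definition creat ::
  "(real ^ 3) set \<Rightarrow> (real ^ 3 \<Rightarrow> nat) \<Rightarrow> real ^ 3 \<Rightarrow> spin \<Rightarrow> complex Matrix.mat" where
  "creat \<Lambda> pos k s = (let p = mode_pos pos k s in
     Matrix.mat (dimH \<Lambda>) (dimH \<Lambda>) (\<lambda>(i, j).
       if \<not> bit j p \<and> i = set_bit p j then (- 1) ^ occ_left p j else 0))"

abbreviation op_sum ::
  "(real ^ 3) set \<Rightarrow> ('b \<Rightarrow> complex Matrix.mat) \<Rightarrow> 'b set \<Rightarrow> complex Matrix.mat" where
  "op_sum \<Lambda> \<equiv> finsum (module_mat TYPE(complex) (dimH \<Lambda>) (dimH \<Lambda>))"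

definition mat_exp :: "complex Matrix.mat \<Rightarrow> complex Matrix.mat" where
  "mat_exp A = Matrix.mat (dim_row A) (dim_row A)
     (\<lambda>(i, j). \<Sum>t. (A ^\<^sub>m t) $$ (i, j) / fact t)"

text \<open>The inner product is taken conjugate linear in the first argument.\<close>

definition inner_prod :: "complex Matrix.vec \<Rightarrow> complex Matrix.vec \<Rightarrow> complex" where
  "inner_prod v w = w \<bullet>c v"

definition pair_annih ::
  "(real ^ 3) set \<Rightarrow> (real ^ 3 \<Rightarrow> nat) \<Rightarrow> real ^ 3 \<Rightarrow> complex Matrix.mat" where
  "pair_annih \<Lambda> pos k = annih \<Lambda> pos (- k) Down * annih \<Lambda> pos k Up"

definition pair_creat ::
  "(real ^ 3) set \<Rightarrow> (real ^ 3 \<Rightarrow> nat) \<Rightarrow> real ^ 3 \<Rightarrow> complex Matrix.mat" where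
  "pair_creat \<Lambda> pos k = creat \<Lambda> pos k Up * creat \<Lambda> pos (- k) Down"

definition G_B ::
  "(real ^ 3) set \<Rightarrow> (real ^ 3 \<Rightarrow> nat) \<Rightarrow> (real ^ 3 \<Rightarrow> real) \<Rightarrow> complex Matrix.mat" where
  "G_B \<Lambda> pos \<theta> = \<i> \<cdot>\<^sub>m op_sum \<Lambda>
     (\<lambda>k. complex_of_real (\<theta> k) \<cdot>\<^sub>m (pair_annih \<Lambda> pos k - pair_creat \<Lambda> pos k)) \<Lambda>"

definition BCS_state ::
  "(real ^ 3) set \<Rightarrow> (real ^ 3 \<Rightarrow> nat) \<Rightarrow> (real ^ 3 \<Rightarrow> real) \<Rightarrow> complex Matrix.vec" where
  "BCS_state \<Lambda> pos \<theta> = mat_exp (\<i> \<cdot>\<^sub>m G_B \<Lambda> pos \<theta>) *\<^sub>v vacuum \<Lambda>"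

text \<open>\<open>(\<Psi>\<^sub>B\<^sub>C\<^sub>S, C\<^bsub>-k\<down>\<^esub> C\<^bsub>k\<up>\<^esub> \<Psi>\<^sub>B\<^sub>C\<^sub>S)\<close>\<close>

definition pair_expect ::
  "(real ^ 3) set \<Rightarrow> (real ^ 3 \<Rightarrow> nat) \<Rightarrow> (real ^ 3 \<Rightarrow> real) \<Rightarrow> real ^ 3 \<Rightarrow> complex" where
  "pair_expect \<Lambda> pos \<theta> k =
     inner_prod (BCS_state \<Lambda> pos \<theta>) (pair_annih \<Lambda> pos k *\<^sub>v BCS_state \<Lambda> pos \<theta>)"

definition kinetic :: "real \<Rightarrow> real \<Rightarrow> real \<Rightarrow> real ^ 3 \<Rightarrow> real" where
  "kinetic hbar m \<mu> k = hbar\<^sup>2 * (norm k)\<^sup>2 / (2 * m) - \<mu>"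

definition H_M ::
  "(real ^ 3) set \<Rightarrow> (real ^ 3 \<Rightarrow> nat) \<Rightarrow> (real ^ 3 \<Rightarrow> real) \<Rightarrow> (real ^ 3 \<Rightarrow> real) \<Rightarrow>
   (real ^ 3 \<Rightarrow> real) \<Rightarrow> complex Matrix.mat" where
  "H_M \<Lambda> pos \<xi> \<Delta> \<theta> =
     op_sum \<Lambda> (\<lambda>(k, s). complex_of_real (\<xi> k) \<cdot>\<^sub>m (creat \<Lambda> pos k s * annih \<Lambda> pos k s))
       (\<Lambda> \<times> {Up, Down})
     - op_sum \<Lambda>
         (\<lambda>k. complex_of_real (\<Delta> k) \<cdot>\<^sub>m (pair_annih \<Lambda> pos k + pair_creat \<Lambda> pos k)) \<Lambda>
     + (\<Sum>k\<in>\<Lambda>. complex_of_real (\<Delta> k) * pair_expect \<Lambda> pos \<theta> k) \<cdot>\<^sub>m 1\<^sub>m (dimH \<Lambda>)"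

definition selfadjoint :: "complex Matrix.mat \<Rightarrow> bool" where
  "selfadjoint A \<longleftrightarrow> square_mat A \<and>
     (\<forall>v \<in> carrier_vec (dim_row A). \<forall>w \<in> carrier_vec (dim_row A).
        inner_prod v (A *\<^sub>v w) = inner_prod (A *\<^sub>v v) w)"

text \<open>The smallest eigenvalue; the eigenvalues of a selfadjoint matrix are real.\<close>

definition ground_state_energy :: "complex Matrix.mat \<Rightarrow> real" where
  "ground_state_energy A = Min (Re ` spectrum A)"

definition ground_state :: "complex Matrix.mat \<Rightarrow> complex Matrix.vec \<Rightarrow> bool" where
  "ground_state A v \<longleftrightarrow> selfadjoint A \<and>
     eigenvector A v (complex_of_real (ground_state_energy A)) \<and> inner_prod v v = 1"

definition E_BCS ::
  "(real ^ 3) set \<Rightarrow> (real ^ 3 \<Rightarrow> nat) \<Rightarrow> (real ^ 3 \<Rightarrow> real) \<Rightarrow> (real ^ 3 \<Rightarrow> real) \<Rightarrow>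
   (real ^ 3 \<Rightarrow> real) \<Rightarrow> complex" where
  "E_BCS \<Lambda> pos \<xi> \<Delta> \<theta> =
     (\<Sum>k\<in>\<Lambda>. complex_of_real (\<xi> k - sqrt ((\<xi> k)\<^sup>2 + (\<Delta> k)\<^sup>2))
            + complex_of_real (\<Delta> k) * pair_expect \<Lambda> pos \<theta> k)"

end

theory Submission
  imports Defs
begin

text \<open>
  The modes split into the pairs \<open>(k\<up>, -k\<down>)\<close>. Since \<open>\<xi>\<close> is even, \<open>H\<^sub>M\<close> is, up to a constant, a sum of
  mutually commuting operators \<open>h\<^sub>k\<close>, each acting on one pair only, and \<open>i G\<^sub>B\<close> is the sum of the
  commuting operators \<open>\<theta>\<^sub>k B\<^sub>k\<close> with \<open>B\<^sub>k = C\<^sub>k\<^sub>\<up>\<^sup>* C\<^sub>-\<^sub>k\<^sub>\<down>\<^sup>* - C\<^sub>-\<^sub>k\<^sub>\<down> C\<^sub>k\<^sub>\<up>\<close>. As \<open>B\<^sub>k\<^sup>3 = - B\<^sub>k\<close>, the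
  exponential of \<open>\<theta>\<^sub>k B\<^sub>k\<close> is a rotation by \<open>\<theta>\<^sub>k\<close> in the plane spanned by the empty and the full pair,
  and it turns \<open>h\<^sub>k\<close> into the diagonal operator with eigenvalue
  \<open>\<xi>\<^sub>k - E\<^sub>k + E\<^sub>k (n\<^sub>k\<^sub>\<up> + n\<^sub>-\<^sub>k\<^sub>\<down>)\<close>, \<open>E\<^sub>k = sqrt (\<xi>\<^sub>k\<^sup>2 + \<Delta>\<^sub>k\<^sup>2)\<close>. Hence \<open>exp (i G\<^sub>B)\<close> diagonalises \<open>H\<^sub>M\<close>
  in the occupation number basis, and the smallest diagonal entry occurs only at the vacuum.
\<close>


unbundle no vec_syntax

section \<open>The exponential of a complex matrix\<close>

lemma index_mult_mat_sum:
  assumes "A \<in> carrier_mat n n" "B \<in> carrier_mat n n" "i < n" "j < n"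
  shows "(A * B) $$ (i, j) = (\<Sum>l<n. A $$ (i, l) * B $$ (l, j))"
  using assms by (auto simp: scalar_prod_def atLeast0LessThan intro!: sum.cong)

lemma pow_mat_commute:
  fixes A :: "'a :: semiring_1 mat"
  assumes A [simp]: "A \<in> carrier_mat n n" and X [simp]: "X \<in> carrier_mat n n" and c: "X * A = A * X"
  shows "X * A ^\<^sub>m t = A ^\<^sub>m t * X"
proof (induction t)
  case 0
  then show ?case by (simp add: carrier_matD[OF A] right_mult_one_mat[OF X] left_mult_one_mat[OF X])
next
  case (Suc t)
  have "X * (A ^\<^sub>m t * A) = X * A ^\<^sub>m t * A"
    by (simp add: assoc_mult_mat[of _ n n _ n _ n])
  also have "\<dots> = A ^\<^sub>m t * (A * X)"
    unfolding Suc by (simp add: assoc_mult_mat[of _ n n _ n _ n] c)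
  finally show ?case by (simp add: assoc_mult_mat[of _ n n _ n _ n])
qed

text \<open>Every further factor in the power sums \<open>n\<close> products and so costs at most
  \<open>real n * a\<close>. This makes the exponential series comparable with a real one.\<close>

lemma pow_mat_entry_le:
  fixes A :: "complex mat"
  assumes A: "A \<in> carrier_mat n n" and a: "\<And>i j. i < n \<Longrightarrow> j < n \<Longrightarrow> cmod (A $$ (i, j)) \<le> a"
    and ij: "i < n" "j < n"
  shows "cmod ((A ^\<^sub>m t) $$ (i, j)) \<le> (real n * a) ^ t"
  using ij
proof (induction t arbitrary: i j)
  case 0
  then show ?case using A by simp
next
  case (Suc t)
  have a0: "0 \<le> a" using a[OF Suc.prems] norm_ge_zero order_trans by blast
  have "cmod ((A ^\<^sub>m Suc t) $$ (i, j)) = cmod (\<Sum>l<n. (A ^\<^sub>m t) $$ (i, l) * A $$ (l, j))"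
    using A Suc.prems by (simp add: index_mult_mat_sum[of _ n] del: index_mult_mat)
  also have "\<dots> \<le> (\<Sum>l<n. cmod ((A ^\<^sub>m t) $$ (i, l)) * cmod (A $$ (l, j)))"
    by (rule order_trans[OF norm_sum]) (simp add: norm_mult)
  also have "\<dots> \<le> (\<Sum>l<n. (real n * a) ^ t * a)"
    using Suc a a0 by (intro sum_mono mult_mono) auto
  also have "\<dots> = (real n * a) ^ Suc t" by (simp add: mult_ac)
  finally show ?case .
qed

lemma mat_exp_carrier [simp]: "A \<in> carrier_mat n n \<Longrightarrow> mat_exp A \<in> carrier_mat n n"
  by (auto simp: mat_exp_def)

lemma mat_exp_index:
  "A \<in> carrier_mat n n \<Longrightarrow> i < n \<Longrightarrow> j < n \<Longrightarrow>
    mat_exp A $$ (i, j) = (\<Sum>t. (A ^\<^sub>m t) $$ (i, j) / fact t)"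
  by (auto simp: mat_exp_def)

text \<open>With \<open>a\<close> bounding all entries, the series is dominated by that of the
  scalar exponential of \<open>real n * a\<close>. The Cauchy product below needs absolute
  convergence.\<close>

lemma summable_norm_mat_exp:
  fixes A :: "complex mat"
  assumes A: "A \<in> carrier_mat n n" and ij: "i < n" "j < n"
  shows "summable (\<lambda>t. norm ((A ^\<^sub>m t) $$ (i, j) / fact t))"
proof -
  define a where "a = Max ((\<lambda>(i, j). cmod (A $$ (i, j))) ` ({..<n} \<times> {..<n}))"
  have a: "cmod (A $$ (i, j)) \<le> a" if "i < n" "j < n" for i j
    unfolding a_def using that by (intro Max_ge) auto
  show ?thesis
  proof (rule summable_comparison_test')
    show "summable (\<lambda>t. (real n * a) ^ t / fact t)"
      using summable_exp_generic[of "real n * a"] by (simp add: field_simps)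
    show "norm (norm ((A ^\<^sub>m t) $$ (i, j) / fact t)) \<le> (real n * a) ^ t / fact t" for t
      using pow_mat_entry_le[OF A a ij, of t] by (simp add: norm_divide divide_right_mono)
  qed
qed

lemmas summable_mat_exp = summable_norm_mat_exp[THEN summable_norm_cancel]

text \<open>\<open>X\<close> commutes with all powers of \<open>A\<close>, and each entry of a
  product with \<open>X\<close> is a finite sum, so the multiplication passes through the
  series.\<close>

lemma mat_exp_commute:
  assumes A: "A \<in> carrier_mat n n" and X: "X \<in> carrier_mat n n" and c: "X * A = A * X"
  shows "X * mat_exp A = mat_exp A * X"
proof (rule eq_matI)
  fix i j assume "i < dim_row (mat_exp A * X)" "j < dim_col (mat_exp A * X)"
  then have ij: "i < n" "j < n" using assms by (auto simp: mat_exp_def)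
  have "(X * mat_exp A) $$ (i, j) = (\<Sum>l<n. \<Sum>t. X $$ (i, l) * ((A ^\<^sub>m t) $$ (l, j) / fact t))"
    unfolding index_mult_mat_sum[OF X mat_exp_carrier[OF A] ij] using A ij
    by (intro sum.cong refl) (simp add: mat_exp_index suminf_mult[OF summable_mat_exp] del: times_divide_eq_right)
  also have "\<dots> = (\<Sum>t. \<Sum>l<n. X $$ (i, l) * ((A ^\<^sub>m t) $$ (l, j) / fact t))"
    using A ij by (intro suminf_sum[symmetric] summable_mult summable_mat_exp) auto
  also have "\<dots> = (\<Sum>t. (X * A ^\<^sub>m t) $$ (i, j) / fact t)"
    using index_mult_mat_sum[OF X pow_carrier_mat[OF A] ij] by (simp add: sum_divide_distrib)
  also have "\<dots> = (\<Sum>t. (A ^\<^sub>m t * X) $$ (i, j) / fact t)"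
    by (simp only: pow_mat_commute[OF A X c])
  also have "\<dots> = (\<Sum>t. \<Sum>l<n. ((A ^\<^sub>m t) $$ (i, l) / fact t) * X $$ (l, j))"
    using index_mult_mat_sum[OF pow_carrier_mat[OF A] X ij] by (simp add: sum_divide_distrib)
  also have "\<dots> = (\<Sum>l<n. \<Sum>t. ((A ^\<^sub>m t) $$ (i, l) / fact t) * X $$ (l, j))"
    using A ij by (intro suminf_sum summable_mult2 summable_mat_exp) auto
  also have "\<dots> = (mat_exp A * X) $$ (i, j)"
    unfolding index_mult_mat_sum[OF mat_exp_carrier[OF A] X ij] using A ij
    by (intro sum.cong refl) (simp add: mat_exp_index suminf_mult2[OF summable_mat_exp] del: times_divide_eq_left)
  finally show "(X * mat_exp A) $$ (i, j) = (mat_exp A * X) $$ (i, j)" .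
qed (use assms in \<open>auto simp: mat_exp_def\<close>)

text \<open>The binomial induction works because commutation moves each new \<open>A\<close> past
  the powers of \<open>B\<close>. In entrywise form the right side is a scalar sum that can be
  inserted into a series.\<close>

lemma pow_mat_add_commuting:
  fixes A B :: "'a :: comm_semiring_1 mat"
  assumes A: "A \<in> carrier_mat n n" and B: "B \<in> carrier_mat n n" and c: "A * B = B * A"
    and ij: "i < n" "j < n"
  shows "((A + B) ^\<^sub>m t) $$ (i, j) =
    (\<Sum>r\<le>t. of_nat (t choose r) * (A ^\<^sub>m r * B ^\<^sub>m (t - r)) $$ (i, j))"
  using ij
proof (induction t arbitrary: i j)
  case 0
  then show ?case using A B by simp
next
  case (Suc t)
  note Ap = pow_carrier_mat[OF A] and Bp = pow_carrier_mat[OF B]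
  have AB: "A + B \<in> carrier_mat n n" using A B by simp
  let ?P = "\<lambda>r s. (A ^\<^sub>m r * B ^\<^sub>m s) $$ (i, j)"
  have stepA: "A ^\<^sub>m r * B ^\<^sub>m s * A = A ^\<^sub>m Suc r * B ^\<^sub>m s" for r s
    using pow_mat_commute[OF B A c, of s] A B
    by (simp add: assoc_mult_mat[of _ n n _ n _ n])
  have stepB: "A ^\<^sub>m r * B ^\<^sub>m s * B = A ^\<^sub>m r * B ^\<^sub>m Suc s" for r s
    using A B by (simp add: assoc_mult_mat[of _ n n _ n _ n])
  have step: "(\<Sum>l<n. (A ^\<^sub>m r * B ^\<^sub>m s) $$ (i, l) * (A + B) $$ (l, j)) = ?P (Suc r) s + ?P r (Suc s)"
    for r s
  proof -
    have M: "A ^\<^sub>m r * B ^\<^sub>m s \<in> carrier_mat n n" using mult_carrier_mat[OF Ap Bp] .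
    have "(\<Sum>l<n. (A ^\<^sub>m r * B ^\<^sub>m s) $$ (i, l) * (A + B) $$ (l, j)) =
        (A ^\<^sub>m r * B ^\<^sub>m s * (A + B)) $$ (i, j)"
      using index_mult_mat_sum[OF M AB Suc.prems] by simp
    also have "A ^\<^sub>m r * B ^\<^sub>m s * (A + B) = A ^\<^sub>m Suc r * B ^\<^sub>m s + A ^\<^sub>m r * B ^\<^sub>m Suc s"
      unfolding mult_add_distrib_mat[OF M A B] stepA stepB ..
    finally show ?thesis using Suc.prems A B Ap Bp
      by (simp add: pow_mat_dim_square[OF A] pow_mat_dim_square[OF B] del: index_mult_mat(1) pow_mat.simps)
  qed
  have "((A + B) ^\<^sub>m Suc t) $$ (i, j) = (\<Sum>l<n. ((A + B) ^\<^sub>m t) $$ (i, l) * (A + B) $$ (l, j))"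
    using AB Suc.prems by (simp add: index_mult_mat_sum[of _ n] del: index_mult_mat index_add_mat)
  also have "\<dots> = (\<Sum>l<n. \<Sum>r\<le>t. of_nat (t choose r) *
      ((A ^\<^sub>m r * B ^\<^sub>m (t - r)) $$ (i, l) * (A + B) $$ (l, j)))"
    using Suc by (intro sum.cong refl) (simp add: sum_distrib_right mult.assoc)
  also have "\<dots> = (\<Sum>r\<le>t. of_nat (t choose r) * (?P (Suc r) (t - r) + ?P r (Suc (t - r))))"
    unfolding step[symmetric] by (subst sum.swap) (simp add: sum_distrib_left)
  also have "\<dots> = (\<Sum>r\<le>Suc t. of_nat (Suc t choose r) * ?P r (Suc t - r))"
  proof -
    \<comment> \<open>Pascal's rule for \<open>Suc t choose Suc r\<close>; the term with index 0 is
      split off beforehand.\<close>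
    have "(\<Sum>r\<le>Suc t. of_nat (Suc t choose r) * ?P r (Suc t - r)) =
        ?P 0 (Suc t) + (\<Sum>r\<le>t. of_nat (t choose r) * ?P (Suc r) (t - r))
          + (\<Sum>r\<le>t. of_nat (t choose Suc r) * ?P (Suc r) (t - r))"
      by (simp add: sum.atMost_Suc_shift algebra_simps sum.distrib
          del: pow_mat.simps index_mult_mat sum.atMost_Suc)
    \<comment> \<open>The top term vanishes, since \<open>t choose Suc t\<close> is 0.\<close>
    also have "(\<Sum>r\<le>t. of_nat (t choose Suc r) * ?P (Suc r) (t - r)) =
        (\<Sum>r<t. of_nat (t choose Suc r) * ?P (Suc r) (t - r))"
      by (rule sum.mono_neutral_right) (auto simp: le_less binomial_eq_0 simp del: pow_mat.simps index_mult_mat)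
    also have "?P 0 (Suc t) + (\<Sum>r\<le>t. of_nat (t choose r) * ?P (Suc r) (t - r)) + \<dots> =
       (\<Sum>r\<le>t. of_nat (t choose r) * ?P (Suc r) (t - r))
       + (\<Sum>r\<le>t. of_nat (t choose r) * ?P r (Suc t - r))"
    proof -
      have "(\<Sum>r\<le>t. of_nat (t choose r) * ?P r (Suc t - r)) =
          ?P 0 (Suc t) + (\<Sum>r<t. of_nat (t choose Suc r) * ?P (Suc r) (Suc t - Suc r))"
        by (subst sum.atMost_shift) simp
      then show ?thesis by (simp add: add_ac del: pow_mat.simps index_mult_mat)
    qed
    also have "(\<Sum>r\<le>t. of_nat (t choose r) * ?P r (Suc t - r)) =
       (\<Sum>r\<le>t. of_nat (t choose r) * ?P r (Suc (t - r)))"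
      by (intro sum.cong refl) (simp add: Suc_diff_le)
    finally show ?thesis by (simp add: distrib_left sum.distrib del: pow_mat.simps index_mult_mat)
  qed
  finally show ?case .
qed

text \<open>The Cauchy product is applied in each entry; the binomial coefficient divided by
  \<open>fact t\<close> leaves exactly the two factorials of the factors.\<close>

lemma mat_exp_add_commuting:
  assumes A: "A \<in> carrier_mat n n" and B: "B \<in> carrier_mat n n" and c: "A * B = B * A"
  shows "mat_exp (A + B) = mat_exp A * mat_exp B"
proof (rule eq_matI)
  fix i j assume "i < dim_row (mat_exp A * mat_exp B)" "j < dim_col (mat_exp A * mat_exp B)"
  then have ij: "i < n" "j < n" using assms by (auto simp: mat_exp_def)
  note Ap = pow_carrier_mat[OF A] and Bp = pow_carrier_mat[OF B]
  let ?a = "\<lambda>l t. (A ^\<^sub>m t) $$ (i, l) / fact t" and ?b = "\<lambda>l t. (B ^\<^sub>m t) $$ (l, j) / fact t"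
  have "(mat_exp A * mat_exp B) $$ (i, j) = (\<Sum>l<n. (\<Sum>t. ?a l t) * (\<Sum>t. ?b l t))"
    unfolding index_mult_mat_sum[OF mat_exp_carrier[OF A] mat_exp_carrier[OF B] ij] using A B ij
    by (intro sum.cong refl) (simp add: mat_exp_index)
  also have "\<dots> = (\<Sum>l<n. \<Sum>t. \<Sum>r\<le>t. ?a l r * ?b l (t - r))"
    using A B ij by (intro sum.cong refl Cauchy_product summable_norm_mat_exp) auto
  also have "\<dots> = (\<Sum>t. \<Sum>l<n. \<Sum>r\<le>t. ?a l r * ?b l (t - r))"
    using A B ij by (intro suminf_sum[symmetric] summable_Cauchy_product summable_norm_mat_exp) auto
  also have "\<dots> = (\<Sum>t. ((A + B) ^\<^sub>m t) $$ (i, j) / fact t)"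
  proof (rule suminf_cong)
    fix t
    have "(\<Sum>l<n. \<Sum>r\<le>t. ?a l r * ?b l (t - r)) =
        (\<Sum>r\<le>t. (\<Sum>l<n. (A ^\<^sub>m r) $$ (i, l) * (B ^\<^sub>m (t - r)) $$ (l, j)) / (fact r * fact (t - r)))"
      by (subst sum.swap) (simp add: sum_divide_distrib)
    also have "\<dots> = (\<Sum>r\<le>t. (A ^\<^sub>m r * B ^\<^sub>m (t - r)) $$ (i, j) / (fact r * fact (t - r)))"
      by (simp only: index_mult_mat_sum[OF Ap Bp ij])
    also have "\<dots> = ((A + B) ^\<^sub>m t) $$ (i, j) / fact t"
      unfolding pow_mat_add_commuting[OF A B c ij] sum_divide_distrib
      by (intro sum.cong refl) (simp add: binomial_fact field_simps del: index_mult_mat)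
    finally show "(\<Sum>l<n. \<Sum>r\<le>t. ?a l r * ?b l (t - r)) = ((A + B) ^\<^sub>m t) $$ (i, j) / fact t" .
  qed
  also have "\<dots> = mat_exp (A + B) $$ (i, j)"
    using B ij by (simp add: mat_exp_index[of "A + B" n])
  finally show "mat_exp (A + B) $$ (i, j) = (mat_exp A * mat_exp B) $$ (i, j)" by simp
qed (use assms in \<open>auto simp: mat_exp_def\<close>)

lemma mat_exp_zero: "mat_exp (0\<^sub>m n n) = 1\<^sub>m n"
proof (rule eq_matI)
  fix i j assume "i < dim_row (1\<^sub>m n :: complex mat)" "j < dim_col (1\<^sub>m n :: complex mat)"
  then have ij: "i < n" "j < n" by auto
  have "((0\<^sub>m n n :: complex mat) ^\<^sub>m t) $$ (i, j) / fact t = (if t = 0 then 1\<^sub>m n $$ (i, j) else 0)" for t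
  proof (cases t)
    case (Suc s)
    then have "(0\<^sub>m n n :: complex mat) ^\<^sub>m t = 0\<^sub>m n n"
      by (simp add: right_mult_zero_mat[of _ n n])
    then show ?thesis using Suc ij by simp
  qed (use ij in simp)
  then have "mat_exp (0\<^sub>m n n) $$ (i, j) = (\<Sum>t. if t = 0 then 1\<^sub>m n $$ (i, j) else 0)"
    using ij by (simp add: mat_exp_index[of _ n])
  also have "\<dots> = 1\<^sub>m n $$ (i, j)"
    using sums_If_finite_set[of "{0 :: nat}" "\<lambda>_. 1\<^sub>m n $$ (i, j) :: complex"] by (simp add: sums_iff)
  finally show "mat_exp (0\<^sub>m n n) $$ (i, j) = 1\<^sub>m n $$ (i, j)" .
qed (auto simp: mat_exp_def)

lemma mat_exp_minus:
  assumes A: "A \<in> carrier_mat n n"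
  shows "mat_exp A * mat_exp (- A) = 1\<^sub>m n" "mat_exp (- A) * mat_exp A = 1\<^sub>m n"
proof -
  have "A * (- A) = (- A) * A" "A + - A = 0\<^sub>m n n" "- A + A = 0\<^sub>m n n" "- A \<in> carrier_mat n n"
    using A by (auto simp: uminus_mult_left_mat uminus_mult_right_mat)
  then show "mat_exp A * mat_exp (- A) = 1\<^sub>m n" "mat_exp (- A) * mat_exp A = 1\<^sub>m n"
    using A by (metis mat_exp_add_commuting mat_exp_zero)+
qed

lemma transpose_pow_mat:
  fixes A :: "'a :: comm_semiring_1 mat"
  assumes A: "A \<in> carrier_mat n n"
  shows "transpose_mat (A ^\<^sub>m t) = transpose_mat A ^\<^sub>m t"
proof (induction t)
  case (Suc t)
  have "transpose_mat (A ^\<^sub>m Suc t) = transpose_mat A * transpose_mat A ^\<^sub>m t"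
    using A by (simp add: transpose_mult[of _ n n _ n] Suc)
  also have "\<dots> = transpose_mat A ^\<^sub>m Suc t"
    using A by (subst pow_mat_commute[of _ n]) auto
  finally show ?case .
qed (use A in simp)

text \<open>For an antisymmetric \<open>A\<close> this turns the transpose of the exponential into
  its inverse.\<close>

lemma transpose_mat_exp:
  assumes A: "A \<in> carrier_mat n n"
  shows "transpose_mat (mat_exp A) = mat_exp (transpose_mat A)"
proof (rule eq_matI)
  fix i j assume "i < dim_row (mat_exp (transpose_mat A))" "j < dim_col (mat_exp (transpose_mat A))"
  then have ij: "i < n" "j < n" using assms by (auto simp: mat_exp_def)
  have "(transpose_mat A ^\<^sub>m t) $$ (i, j) = (A ^\<^sub>m t) $$ (j, i)" for t
    using A ij by (simp add: transpose_pow_mat[OF A, symmetric] pow_mat_dim_square)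
  then show "transpose_mat (mat_exp A) $$ (i, j) = mat_exp (transpose_mat A) $$ (i, j)"
    using A ij by (simp add: mat_exp_index[of _ n] carrier_matD[OF mat_exp_carrier[OF A]])
qed (use assms in \<open>auto simp: mat_exp_def\<close>)

text \<open>The imaginary parts of all terms vanish, hence so does that of the sum. Reality lets the
  transpose stand in for the adjoint.\<close>

lemma mat_exp_Reals:
  assumes A: "A \<in> carrier_mat n n" and re: "\<And>i j. i < n \<Longrightarrow> j < n \<Longrightarrow> A $$ (i, j) \<in> \<real>"
    and ij: "i < n" "j < n"
  shows "mat_exp A $$ (i, j) \<in> \<real>"
proof -
  have pow: "(A ^\<^sub>m t) $$ (i, j) \<in> \<real>" if "i < n" "j < n" for i j t
    using that
  proof (induction t arbitrary: i j)
    case (Suc t)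
    then show ?case using A re
      by (auto simp: index_mult_mat_sum[of _ n] simp del: index_mult_mat intro!: sum_in_Reals)
  qed (use A in simp)
  have "(\<lambda>t. (A ^\<^sub>m t) $$ (i, j) / fact t) sums mat_exp A $$ (i, j)"
    using summable_mat_exp[OF A ij] A ij by (simp add: mat_exp_index summable_sums)
  then have "(\<lambda>t. Im ((A ^\<^sub>m t) $$ (i, j) / fact t)) sums Im (mat_exp A $$ (i, j))"
    by (simp add: sums_complex_iff)
  moreover have "Im ((A ^\<^sub>m t) $$ (i, j) / fact t) = 0" for t
  proof -
    have "(A ^\<^sub>m t) $$ (i, j) / fact t \<in> \<real>"
      using pow[OF ij, of t] Reals_of_nat[of "fact t", where 'a = complex] by (auto intro: Reals_divide)
    then show ?thesis by (simp only: complex_is_Real_iff)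
  qed
  ultimately show ?thesis
    using sums_unique2[OF sums_zero, of "Im (mat_exp A $$ (i, j))"] by (simp add: complex_is_Real_iff)
qed

text \<open>This is Rodrigues' rotation formula: powers of positive order are, up to sign,
  \<open>B\<close> or \<open>B * B\<close>, so the odd terms collect to a sine and the even ones to
  a cosine.\<close>

lemma mat_exp_cube_eq_uminus:
  assumes B: "B \<in> carrier_mat n n" and cube: "B * B * B = - B"
  shows "mat_exp (complex_of_real \<theta> \<cdot>\<^sub>m B) =
    1\<^sub>m n + B * B + complex_of_real (sin \<theta>) \<cdot>\<^sub>m B - complex_of_real (cos \<theta>) \<cdot>\<^sub>m (B * B)"
    (is "?l = ?r")
proof (rule eq_matI)
  fix i j assume "i < dim_row ?r" "j < dim_col ?r"
  then have ij: "i < n" "j < n" using B by auto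
  let ?c = "complex_of_real"
  have odd: "B ^\<^sub>m (2 * t + 1) = (- 1) ^ t \<cdot>\<^sub>m B" for t
  proof (induction t)
    case (Suc t)
    have "B ^\<^sub>m (2 * Suc t + 1) = B ^\<^sub>m (2 * t + 1) * B * B" using B by simp
    also have "\<dots> = (- 1) ^ t \<cdot>\<^sub>m (B * B * B)"
      unfolding Suc using B by (simp add: mult_smult_assoc_mat[of _ n n _ n])
    finally show ?case unfolding cube using B by (auto intro!: eq_matI)
  qed (use B in \<open>auto intro!: eq_matI\<close>)
  \<comment> \<open>The cosine series would contribute \<open>- (B * B)\<close> at order 0, where
    the power is the identity; the term at \<open>t = 0\<close> corrects this.\<close>
  have coeff: "((?c \<theta> \<cdot>\<^sub>m B) ^\<^sub>m t) $$ (i, j) / fact t =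
      (if t = 0 then (1\<^sub>m n + B * B) $$ (i, j) else 0)
      + ?c (sin_coeff t *\<^sub>R \<theta> ^ t) * B $$ (i, j) - ?c (cos_coeff t *\<^sub>R \<theta> ^ t) * (B * B) $$ (i, j)" for t
  proof -
    have "(?c \<theta> \<cdot>\<^sub>m B) ^\<^sub>m t = ?c (\<theta> ^ t) \<cdot>\<^sub>m (B ^\<^sub>m t)"
      using B by (induction t)
        (auto simp: mult_smult_assoc_mat[of _ n n _ n] mult_smult_distrib[of _ n n _ n] intro!: eq_matI)
    then have 1: "((?c \<theta> \<cdot>\<^sub>m B) ^\<^sub>m t) $$ (i, j) = ?c (\<theta> ^ t) * (B ^\<^sub>m t) $$ (i, j)"
      using B ij by (simp add: pow_mat_dim_square)
    consider "t = 0" | s where "t = 2 * s + 1" | s where "t = 2 * s + 2"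
      by (metis Suc_eq_plus1 add_2_eq_Suc' evenE mult_Suc_right not0_implies_Suc oddE add.commute)
    then show ?thesis
    proof cases
      case 1
      then show ?thesis using B ij by (simp add: cos_coeff_def sin_coeff_def)
    next
      case 2
      then show ?thesis unfolding 1 using odd[of s] B ij
        by (simp add: cos_coeff_def sin_coeff_def field_simps del: pow_mat.simps)
    next
      case 3
      have "B ^\<^sub>m t = (- 1) ^ s \<cdot>\<^sub>m (B * B)"
        using odd[of s] 3 B by (simp add: mult_smult_assoc_mat[of _ n n _ n])
      then show ?thesis unfolding 1 using 3 B ij
        by (simp add: cos_coeff_def sin_coeff_def field_simps del: pow_mat.simps index_mult_mat(1))
    qed
  qed
  have "(\<lambda>t. (if t = 0 then (1\<^sub>m n + B * B) $$ (i, j) else 0)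
      + ?c (sin_coeff t *\<^sub>R \<theta> ^ t) * B $$ (i, j) - ?c (cos_coeff t *\<^sub>R \<theta> ^ t) * (B * B) $$ (i, j))
     sums ((1\<^sub>m n + B * B) $$ (i, j) + ?c (sin \<theta>) * B $$ (i, j) - ?c (cos \<theta>) * (B * B) $$ (i, j))"
    using sums_If_finite_set[of "{0 :: nat}" "\<lambda>_. (1\<^sub>m n + B * B) $$ (i, j)"]
    by (intro sums_add sums_diff sums_mult2 sums_of_real sin_converges cos_converges)
      (simp del: index_mult_mat index_add_mat)
  then have "?l $$ (i, j) = \<dots>"
    using B ij coeff by (simp add: mat_exp_index[of _ n] sums_iff del: index_mult_mat index_add_mat)
  then show "?l $$ (i, j) = ?r $$ (i, j)" using B ij by simp
qed (use B in \<open>auto simp: mat_exp_def\<close>)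


section \<open>Sums of matrices and diagonalisation\<close>

text \<open>Fixing the size \<open>n\<close> gives the empty sum a meaning, and the entries are
  ordinary scalar sums. By \<open>finsum_module_mat\<close> it agrees with the module sum behind
  \<open>op_sum\<close>.\<close>

definition mat_sum :: "nat \<Rightarrow> ('b \<Rightarrow> 'a :: comm_monoid_add mat) \<Rightarrow> 'b set \<Rightarrow> 'a mat" where
  "mat_sum n f S = Matrix.mat n n (\<lambda>(i, j). \<Sum>k\<in>S. f k $$ (i, j))"

lemma mat_sum_carrier [simp]: "mat_sum n f S \<in> carrier_mat n n"
  by (simp add: mat_sum_def)

lemma mat_sum_dim [simp]: "dim_row (mat_sum n f S) = n" "dim_col (mat_sum n f S) = n"
  by (simp_all add: mat_sum_def)

lemma index_mat_sum [simp]: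
  "i < n \<Longrightarrow> j < n \<Longrightarrow> mat_sum n f S $$ (i, j) = (\<Sum>k\<in>S. f k $$ (i, j))"
  by (simp add: mat_sum_def)

lemma mat_sum_empty: "mat_sum n f {} = 0\<^sub>m n n"
  by (auto intro!: eq_matI)

lemma mat_sum_insert:
  "finite S \<Longrightarrow> x \<notin> S \<Longrightarrow> f x \<in> carrier_mat n n \<Longrightarrow>
    mat_sum n f (insert x S) = f x + mat_sum n f S"
  by (auto intro!: eq_matI)

lemma finsum_module_mat:
  fixes f :: "'b \<Rightarrow> 'a :: comm_ring_1 mat"
  assumes "finite S" "\<And>x. x \<in> S \<Longrightarrow> f x \<in> carrier_mat n n"
  shows "finsum (module_mat TYPE('a) n n) f S = mat_sum n f S"
  using assms
proof (induction S)
  interpret abelian_group "module_mat TYPE('a) n n" by (rule abelian_group_mat)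
  {
    case empty
    show ?case by (simp add: mat_sum_empty module_mat_simps)
  next
    case (insert x S)
    then show ?case
      by (subst finsum_insert) (auto simp: mat_sum_insert module_mat_simps)
  }
qed

lemma mat_sum_commute:
  fixes A :: "'a :: comm_ring_1 mat"
  assumes "finite S" and A: "A \<in> carrier_mat n n"
    and "\<And>k. k \<in> S \<Longrightarrow> f k \<in> carrier_mat n n"
    and "\<And>k. k \<in> S \<Longrightarrow> A * f k = f k * A"
  shows "A * mat_sum n f S = mat_sum n f S * A"
  using assms(1,3,4)
proof (induction S)
  case empty
  then show ?case using A by (simp add: mat_sum_empty)
next
  case (insert x S)
  then show ?case using A
    by (simp add: mat_sum_insert mult_add_distrib_mat[of _ n n _ n] add_mult_distrib_mat[of _ n n _ _ n])
qed

text \<open>The exponential of the sum factors as \<open>R * U\<close>, with \<open>R\<close>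
  belonging to the new index. \<open>A x\<close> turns into \<open>D x\<close> when it passes
  \<open>R\<close> and then commutes with \<open>U\<close>; the remaining sum commutes with
  \<open>R\<close> and is converted by \<open>U\<close>. Thus diagonalising each pair diagonalises
  the whole sum.\<close>

lemma mat_sum_exp_intertwine:
  assumes "finite S"
    and car: "\<And>k. k \<in> S \<Longrightarrow> A k \<in> carrier_mat n n"
      "\<And>k. k \<in> S \<Longrightarrow> B k \<in> carrier_mat n n" "\<And>k. k \<in> S \<Longrightarrow> D k \<in> carrier_mat n n"
    and comm: "\<And>k l. k \<in> S \<Longrightarrow> l \<in> S \<Longrightarrow> k \<noteq> l \<Longrightarrow> B k * B l = B l * B k"
      "\<And>k l. k \<in> S \<Longrightarrow> l \<in> S \<Longrightarrow> k \<noteq> l \<Longrightarrow> A k * B l = B l * A k"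
      "\<And>k l. k \<in> S \<Longrightarrow> l \<in> S \<Longrightarrow> k \<noteq> l \<Longrightarrow> D k * B l = B l * D k"
    and intertwine: "\<And>k. k \<in> S \<Longrightarrow> A k * mat_exp (B k) = mat_exp (B k) * D k"
  shows "mat_sum n A S * mat_exp (mat_sum n B S) = mat_exp (mat_sum n B S) * mat_sum n D S"
  using assms
proof (induction S)
  case empty
  then show ?case by (simp add: mat_sum_empty mat_exp_zero left_mult_zero_mat[of _ n n] right_mult_zero_mat[of _ n n])
next
  case (insert x S)
  note car = insert.prems(1-3)
  let ?A = "mat_sum n A S" and ?D = "mat_sum n D S"
  define R where "R = mat_exp (B x)"
  define U where "U = mat_exp (mat_sum n B S)"
  have x [simp]: "A x \<in> carrier_mat n n" "B x \<in> carrier_mat n n" "D x \<in> carrier_mat n n"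
    and [simp]: "R \<in> carrier_mat n n" "U \<in> carrier_mat n n"
    using car by (auto simp: R_def U_def)
  have ne: "k \<noteq> x" "x \<noteq> k" if "k \<in> S" for k
    using insert.hyps that by auto
  have BB: "B x * mat_sum n B S = mat_sum n B S * B x"
    using insert.hyps car insert.prems(4)[of x] ne by (intro mat_sum_commute) auto
  have RU: "mat_exp (mat_sum n B (insert x S)) = R * U"
    unfolding R_def U_def using insert.hyps x
    by (simp add: mat_sum_insert mat_exp_add_commuting[of _ n, OF _ _ BB])
  have AR: "?A * R = R * ?A"
    unfolding R_def using insert.hyps car insert.prems(5)[of _ x] ne
    by (intro mat_exp_commute[of _ n] mat_sum_commute[symmetric]) auto
  have DU: "D x * U = U * D x"
    unfolding U_def using insert.hyps car insert.prems(6)[of x] ne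
    by (intro mat_exp_commute[of _ n] mat_sum_commute) auto
  have IH: "?A * U = U * ?D"
    unfolding U_def using insert by (intro insert.IH) auto
  have AxR: "A x * R = R * D x"
    unfolding R_def using insert by auto
  note assoc = assoc_mult_mat[of _ n n _ n _ n]
  have "(A x + ?A) * (R * U) = A x * R * U + ?A * R * U"
    by (simp add: add_mult_distrib_mat[of _ n n _ _ n] mult_carrier_mat[of _ n n _ n] assoc)
  also have "\<dots> = R * (D x * U) + R * (?A * U)"
    by (simp add: AxR AR assoc)
  also have "\<dots> = R * U * (D x + ?D)"
    by (simp add: DU IH mult_add_distrib_mat[of _ n n _ n] mult_carrier_mat[of _ n n _ n] assoc)
  finally show ?case
    using insert.hyps by (simp add: RU mat_sum_insert[of S x A] mat_sum_insert[of S x D])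
qed

section \<open>Matrices similar to a diagonal matrix\<close>

lemma mat_diag_mult_vec:
  fixes d :: "nat \<Rightarrow> 'a :: comm_semiring_1"
  assumes "v \<in> carrier_vec n" "i < n"
  shows "(mat_diag n d *\<^sub>v v) $ i = d i * v $ i"
  using assms by (simp add: mat_diag_def scalar_prod_def mult_delta_left)

lemma mult_unit_vec:
  "A \<in> carrier_mat n n \<Longrightarrow> j < n \<Longrightarrow> A *\<^sub>v unit_vec n j = (col A j :: 'a :: semiring_1 vec)"
  by (auto intro!: eq_vecI)

text \<open>Only similarity is assumed: \<open>V\<close> is an inverse of \<open>U\<close>, and
  eigenvectors are read off from their coordinates \<open>V *\<^sub>v v\<close> with respect to the
  columns of \<open>U\<close>.\<close>

locale diagonalised =
  fixes n :: nat and H U V :: "complex mat" and d :: "nat \<Rightarrow> complex"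
  assumes carrier: "H \<in> carrier_mat n n" "U \<in> carrier_mat n n" "V \<in> carrier_mat n n"
    and inverse: "U * V = 1\<^sub>m n" "V * U = 1\<^sub>m n"
    and HU: "H * U = U * mat_diag n d"
begin

lemma VH: "V * H = mat_diag n d * V"
proof -
  have D: "mat_diag n d \<in> carrier_mat n n" by simp
  have "V * H = V * (H * (U * V))" using carrier by (simp add: inverse)
  also have "\<dots> = V * (H * U) * V" using carrier by (simp add: assoc_mult_mat[of _ n n _ n _ n])
  also have "\<dots> = V * U * mat_diag n d * V"
    unfolding HU using carrier D by (simp add: assoc_mult_mat[of _ n n _ n _ n])
  finally show ?thesis using D by (simp add: inverse)
qed

text \<open>In these coordinates \<open>H\<close> acts diagonally, so the difference of
  \<open>d i\<close> and \<open>e\<close> annihilates the \<open>i\<close>-th coordinate.\<close>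

lemma eigenvector_coordinates:
  assumes "eigenvector H v e" "i < n" "d i \<noteq> e"
  shows "(V *\<^sub>v v) $ i = 0"
proof -
  have v: "v \<in> carrier_vec n" and Hv: "H *\<^sub>v v = e \<cdot>\<^sub>v v"
    using assms carrier by (auto simp: eigenvector_def)
  have "mat_diag n d *\<^sub>v (V *\<^sub>v v) = V *\<^sub>v (H *\<^sub>v v)"
    using carrier v VH by (simp add: assoc_mult_mat_vec[of _ n n _ n, symmetric])
  also have "\<dots> = e \<cdot>\<^sub>v (V *\<^sub>v v)"
    using carrier v Hv by (simp add: mult_mat_vec)
  finally have "(mat_diag n d *\<^sub>v (V *\<^sub>v v)) $ i = e * (V *\<^sub>v v) $ i"
    using carrier assms by simp
  then show ?thesis
    using assms carrier v by (subst (asm) mat_diag_mult_vec) auto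
qed

lemma eigenvector_expand:
  assumes "eigenvector H v e"
  shows "U *\<^sub>v (V *\<^sub>v v) = v"
  using assms carrier inverse
  by (simp add: eigenvector_def assoc_mult_mat_vec[of _ n n _ n, symmetric])

lemma eigenvector_col:
  assumes "j < n"
  shows "eigenvector H (U *\<^sub>v unit_vec n j) (d j)"
proof -
  have "mat_diag n d *\<^sub>v unit_vec n j = d j \<cdot>\<^sub>v unit_vec n j"
    using assms by (intro eq_vecI) (auto simp: mat_diag_mult_vec mat_diag_def)
  then have "H *\<^sub>v (U *\<^sub>v unit_vec n j) = d j \<cdot>\<^sub>v (U *\<^sub>v unit_vec n j)"
    using carrier HU mult_mat_vec[of U n n "unit_vec n j" "d j"]
      assoc_mult_mat_vec[of H n n U n "unit_vec n j"]
      assoc_mult_mat_vec[of U n n "mat_diag n d" n "unit_vec n j"] by simp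
  moreover have "U *\<^sub>v unit_vec n j \<noteq> 0\<^sub>v n"
  proof
    assume "U *\<^sub>v unit_vec n j = 0\<^sub>v n"
    then have "V * U *\<^sub>v unit_vec n j = V *\<^sub>v 0\<^sub>v n"
      using carrier by (simp add: assoc_mult_mat_vec[of _ n n _ n])
    moreover have "V *\<^sub>v 0\<^sub>v n = 0\<^sub>v n"
      using carrier by (intro eq_vecI) auto
    ultimately have "unit_vec n j = (0\<^sub>v n :: complex vec)"
      by (simp add: inverse)
    then show False using assms by (simp add: unit_vec_nonzero)
  qed
  ultimately show ?thesis using carrier by (auto simp: eigenvector_def)
qed

lemma spectrum: "spectrum H = d ` {..<n}"
proof
  show "d ` {..<n} \<subseteq> spectrum H"
    using eigenvector_col unfolding spectrum_def eigenvalue_def by blast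
  show "spectrum H \<subseteq> d ` {..<n}"
  proof
    fix e assume "e \<in> spectrum H"
    then obtain v where v: "eigenvector H v e" by (auto simp: spectrum_def eigenvalue_def)
    show "e \<in> d ` {..<n}"
    proof (rule ccontr)
      assume "e \<notin> d ` {..<n}"
      then have "V *\<^sub>v v = 0\<^sub>v n"
        using eigenvector_coordinates[OF v] carrier by (intro eq_vecI) auto
      then have "v = 0\<^sub>v n"
        using eigenvector_expand[OF v] carrier by auto
      then show False using v carrier by (auto simp: eigenvector_def)
    qed
  qed
qed

text \<open>All coordinates other than the \<open>j\<close>-th vanish. This will give uniqueness of
  the ground state.\<close>

lemma simple_eigenvector:
  assumes v: "eigenvector H v (d j)" and j: "j < n"
    and simple: "\<And>i. i < n \<Longrightarrow> i \<noteq> j \<Longrightarrow> d i \<noteq> d j"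
  shows "\<exists>c. v = c \<cdot>\<^sub>v (U *\<^sub>v unit_vec n j)"
proof -
  have "V *\<^sub>v v = (V *\<^sub>v v) $ j \<cdot>\<^sub>v unit_vec n j"
    using eigenvector_coordinates[OF v] simple carrier j by (intro eq_vecI) (auto simp: unit_vec_def)
  then have "v = U *\<^sub>v ((V *\<^sub>v v) $ j \<cdot>\<^sub>v unit_vec n j)"
    using eigenvector_expand[OF v] by simp
  also have "\<dots> = (V *\<^sub>v v) $ j \<cdot>\<^sub>v (U *\<^sub>v unit_vec n j)"
    using carrier by (intro mult_mat_vec) auto
  finally show ?thesis by blast
qed

end

lemma selfadjointI:
  assumes A: "A \<in> carrier_mat n n"
    and sym: "\<And>i j. i < n \<Longrightarrow> j < n \<Longrightarrow> cnj (A $$ (j, i)) = A $$ (i, j)"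
  shows "selfadjoint A"
proof -
  have "inner_prod v (A *\<^sub>v w) = inner_prod (A *\<^sub>v v) w"
    if v: "v \<in> carrier_vec n" and w: "w \<in> carrier_vec n" for v w
  proof -
    have "inner_prod v (A *\<^sub>v w) = (\<Sum>i<n. \<Sum>j<n. A $$ (i, j) * w $ j * cnj (v $ i))"
      using A v w by (auto simp: inner_prod_def scalar_prod_def atLeast0LessThan sum_distrib_right intro!: sum.cong)
    also have "\<dots> = (\<Sum>j<n. \<Sum>i<n. w $ j * cnj (A $$ (j, i) * v $ i))"
      by (subst sum.swap) (auto simp: sym mult_ac intro!: sum.cong)
    also have "\<dots> = inner_prod (A *\<^sub>v v) w"
      using A v w by (auto simp: inner_prod_def scalar_prod_def atLeast0LessThan sum_distrib_left intro!: sum.cong)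
    finally show ?thesis .
  qed
  then show ?thesis using A by (auto simp: selfadjoint_def)
qed

section \<open>Matrices supported on the graph of an involution\<close>

text \<open>The shape of an operator acting on one pair: basis vector \<open>j\<close> stays with
  amplitude \<open>a j\<close> and moves to \<open>f j\<close> with amplitude \<open>b j\<close>.
  The two contributions are added, so coinciding indices need no separate clause.\<close>

definition invol_mat ::
  "nat \<Rightarrow> (nat \<Rightarrow> nat) \<Rightarrow> (nat \<Rightarrow> 'a) \<Rightarrow> (nat \<Rightarrow> 'a) \<Rightarrow> 'a :: comm_ring_1 mat" where
  "invol_mat n f a b =
     Matrix.mat n n (\<lambda>(i, j). (if i = j then a j else 0) + (if i = f j then b j else 0))"

lemma invol_mat_carrier [simp]: "invol_mat n f a b \<in> carrier_mat n n"
  by (simp add: invol_mat_def)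

lemma invol_mat_dim [simp]: "dim_row (invol_mat n f a b) = n" "dim_col (invol_mat n f a b) = n"
  by (simp_all add: invol_mat_def)

lemma index_invol_mat:
  "i < n \<Longrightarrow> j < n \<Longrightarrow>
    invol_mat n f a b $$ (i, j) = (if i = j then a j else 0) + (if i = f j then b j else 0)"
  by (simp add: invol_mat_def)

text \<open>Column \<open>j\<close> of the right factor is supported on \<open>j\<close> and
  \<open>g j\<close>, which leaves four paths from \<open>j\<close> to \<open>i\<close>.\<close>

lemma index_mult_invol_mat:
  assumes "i < n" "j < n" "g j < n"
  shows "(invol_mat n f a b * invol_mat n g c d) $$ (i, j) =
    (if i = j then a j * c j else 0) + (if i = f j then b j * c j else 0)
    + (if i = g j then a (g j) * d j else 0) + (if i = f (g j) then b (g j) * d j else 0)"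
proof -
  let ?X = "\<lambda>l. (if i = l then a l else 0) + (if i = f l then b l else 0)"
  have "(invol_mat n f a b * invol_mat n g c d) $$ (i, j) =
      (\<Sum>l<n. ?X l * ((if l = j then c j else 0) + (if l = g j then d j else 0)))"
    unfolding index_mult_mat_sum[OF invol_mat_carrier invol_mat_carrier assms(1,2)]
    using assms by (intro sum.cong) (auto simp: index_invol_mat)
  also have "\<dots> = (\<Sum>l<n. if l = j then ?X j * c j else 0) + (\<Sum>l<n. if l = g j then ?X (g j) * d j else 0)"
    unfolding sum.distrib[symmetric] by (intro sum.cong) (auto simp: distrib_left)
  also have "\<dots> = ?X j * c j + ?X (g j) * d j"
    using assms by simp
  finally show ?thesis using assms by (auto simp: algebra_simps)
qed

lemma mult_invol_mat:
  assumes "\<And>j. j < n \<Longrightarrow> f j < n" "\<And>j. f (f j) = j"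
  shows "invol_mat n f a b * invol_mat n f c d =
    invol_mat n f (\<lambda>j. a j * c j + b (f j) * d j) (\<lambda>j. b j * c j + a (f j) * d j)"
  using assms by (intro eq_matI) (auto simp: index_mult_invol_mat index_invol_mat simp del: index_mult_mat(1))

text \<open>Comparing the four paths in both orders, the staying amplitudes must be invariant under
  the other involution; the last hypothesis equates the amplitudes of the two ways of moving by
  both, where the fermionic signs enter.\<close>

lemma invol_mat_commute:
  assumes "\<And>j. j < n \<Longrightarrow> f j < n" "\<And>j. j < n \<Longrightarrow> g j < n" "\<And>j. f (g j) = g (f j)"
    and "\<And>j. a (g j) = a j" "\<And>j. c (f j) = c j" "\<And>j. b (g j) * d j = d (f j) * b j"
  shows "invol_mat n f a b * invol_mat n g c d = invol_mat n g c d * invol_mat n f a b"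
proof -
  \<comment> \<open>This serves the degenerate comparison in which two of the image indices
    coincide.\<close>
  have "a (f j) = a j" if "g j = g (f j)" for j
    using assms(4) that by metis
  then show ?thesis
    using assms by (intro eq_matI) (auto simp: index_mult_invol_mat mult_ac simp del: index_mult_mat(1))
qed


section \<open>Pair operators in the occupation number basis\<close>

text \<open>The sign is a product of one factor per site to the left of \<open>p\<close>; flipping
  bit \<open>q\<close> negates its factor, which is present only for \<open>q < p\<close>.\<close>

lemma sign_occ_left_flip_bit:
  "(- 1 :: 'a :: comm_ring_1) ^ occ_left p (flip_bit q j) =
     (if q < p then - 1 else 1) * (- 1) ^ occ_left p j"
proof -
  let ?s = "\<lambda>j r. (- 1 :: 'a) ^ of_bool (bit j r)"
  have prod: "(- 1 :: 'a) ^ occ_left p j = (\<Prod>r<p. ?s j r)" for j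
    unfolding occ_left_def by (rule power_sum)
  have other: "?s (flip_bit q j) r = ?s j r" if "r \<noteq> q" for r
    using that by (simp add: bit_flip_bit_iff)
  show ?thesis
  proof (cases "q < p")
    case True
    have "(\<Prod>r<p. ?s (flip_bit q j) r) = ?s (flip_bit q j) q * (\<Prod>r\<in>{..<p} - {q}. ?s (flip_bit q j) r)"
      using True by (intro prod.remove) auto
    also have "\<dots> = - (?s j q * (\<Prod>r\<in>{..<p} - {q}. ?s j r))"
      by (simp add: other bit_flip_bit_iff)
    also have "?s j q * (\<Prod>r\<in>{..<p} - {q}. ?s j r) = (\<Prod>r<p. ?s j r)"
      using True by (intro prod.remove[symmetric]) auto
    finally show ?thesis using True by (simp add: prod)
  next
    case False
    then show ?thesis unfolding prod by (auto simp: other intro!: prod.cong)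
  qed
qed

lemma sum_single:
  assumes "finite A" "x \<in> A" "\<And>y. y \<in> A \<Longrightarrow> y \<noteq> x \<Longrightarrow> g y = (0 :: 'a :: comm_monoid_add)"
  shows "sum g A = g x"
  using assms by (simp add: sum.remove[of A x])

lemma flip_bit_less_power: "j < 2 ^ m \<Longrightarrow> p < m \<Longrightarrow> flip_bit p j < (2 :: nat) ^ m"
  by (metis take_bit_flip_bit_eq take_bit_nat_eq_self_iff not_less)

lemma flip_bit_flip_bit [simp]: "flip_bit p (flip_bit p j) = (j :: nat)"
  by (rule bit_eqI) (auto simp: bit_flip_bit_iff)

lemma flip_bit_commute: "flip_bit p (flip_bit q j) = flip_bit q (flip_bit p (j :: nat))"
  by (rule bit_eqI) (auto simp: bit_flip_bit_iff)

section \<open>Pairs of modes and their signs\<close>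

locale momentum_modes =
  fixes \<Lambda> :: "(real ^ 3) set" and pos :: "real ^ 3 \<Rightarrow> nat"
  assumes pos: "bij_betw pos \<Lambda> {..<card \<Lambda>}"
    and uminus_mem: "k \<in> \<Lambda> \<Longrightarrow> - k \<in> \<Lambda>"
begin

abbreviation "dH \<equiv> dimH \<Lambda>"

lemma finite: "finite \<Lambda>"
proof (rule ccontr)
  assume "\<not> finite \<Lambda>"
  \<comment> \<open>An infinite set has \<open>card\<close> 0, so \<open>pos\<close> would be a
    bijection onto the empty set.\<close>
  with pos have "\<Lambda> = {}" by (simp add: bij_betw_def)
  with \<open>\<not> finite \<Lambda>\<close> show False by simp
qed

lemma pos_less: "k \<in> \<Lambda> \<Longrightarrow> pos k < card \<Lambda>"
  using pos by (auto simp: bij_betw_def)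

lemma pos_eq_iff: "k \<in> \<Lambda> \<Longrightarrow> l \<in> \<Lambda> \<Longrightarrow> pos k = pos l \<longleftrightarrow> k = l"
  using pos by (auto simp: bij_betw_def inj_on_def)

text \<open>The pair with label \<open>k\<close> consists of \<open>k\<up>\<close> and \<open>-k\<down>\<close>; note the sign in \<open>down\<close>.\<close>

definition up :: "real ^ 3 \<Rightarrow> nat" where "up k = 2 * pos k"
definition down :: "real ^ 3 \<Rightarrow> nat" where "down k = 2 * pos (- k) + 1"

lemma mode_pos_eq: "mode_pos pos k Up = up k" "mode_pos pos (- k) Down = down k"
    "mode_pos pos k Down = down (- k)"
  by (simp_all add: up_def down_def)

lemma up_neq_down [simp]: "up k \<noteq> down l" "down l \<noteq> up k"
  unfolding up_def down_def by presburger+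

lemma up_eq_iff: "k \<in> \<Lambda> \<Longrightarrow> l \<in> \<Lambda> \<Longrightarrow> up k = up l \<longleftrightarrow> k = l"
  by (simp add: up_def pos_eq_iff)

lemma down_eq_iff: "k \<in> \<Lambda> \<Longrightarrow> l \<in> \<Lambda> \<Longrightarrow> down k = down l \<longleftrightarrow> k = l"
  by (simp add: down_def pos_eq_iff uminus_mem)

lemma up_less: "k \<in> \<Lambda> \<Longrightarrow> up k < 2 * card \<Lambda>"
  using pos_less[of k] by (simp add: up_def)

lemma down_less: "k \<in> \<Lambda> \<Longrightarrow> down k < 2 * card \<Lambda>"
  using pos_less[of "- k"] by (simp add: down_def uminus_mem)

lemma flip_up_less: "k \<in> \<Lambda> \<Longrightarrow> j < dH \<Longrightarrow> flip_bit (up k) j < dH"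
  unfolding dimH_def by (intro flip_bit_less_power up_less)

lemma flip_down_less: "k \<in> \<Lambda> \<Longrightarrow> j < dH \<Longrightarrow> flip_bit (down k) j < dH"
  unfolding dimH_def by (intro flip_bit_less_power down_less)

definition flip :: "real ^ 3 \<Rightarrow> nat \<Rightarrow> nat" where
  "flip k j = flip_bit (up k) (flip_bit (down k) j)"

lemma flip_less: "k \<in> \<Lambda> \<Longrightarrow> j < dH \<Longrightarrow> flip k j < dH"
  unfolding flip_def by (intro flip_up_less flip_down_less)

lemma bit_flip: "bit (flip k j) r \<longleftrightarrow> (bit j r \<noteq> (r = up k \<or> r = down k))"
proof -
  have "up k \<noteq> down k" "possible_bit TYPE(nat) r" by simp_all
  then show ?thesis unfolding flip_def bit_flip_bit_iff by metis
qed

lemma flip_flip [simp]: "flip k (flip k j) = j"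
  by (rule bit_eqI) (auto simp: bit_flip)

lemma flip_commute: "flip k (flip l j) = flip l (flip k j)"
  by (rule bit_eqI) (auto simp: bit_flip)

lemma flip_neq [simp]: "flip k j \<noteq> j" "j \<noteq> flip k j"
  using bit_flip[of k j "up k"] by auto

text \<open>The sign produced by toggling first the down mode and then the up mode, as in the pair
  creation operator. The first factor records that the down mode has already changed when the up
  mode counts the sites to its left.\<close>

definition pair_sign :: "real ^ 3 \<Rightarrow> nat \<Rightarrow> complex" where
  "pair_sign k j =
     (if down k < up k then - 1 else 1) * (- 1) ^ occ_left (up k) j * (- 1) ^ occ_left (down k) j"

lemma pair_sign_square [simp]: "pair_sign k j * pair_sign k j = 1"
  by (simp add: pair_sign_def power_mult_distrib[symmetric] flip: power_add)

text \<open>Exactly one of the two modes lies to the left of the other, so exactly one of the two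
  counts changes parity.\<close>

lemma pair_sign_flip_self: "pair_sign k (flip k j) = - pair_sign k j"
  using up_neq_down(1)[of k k] by (auto simp: pair_sign_def flip_def sign_occ_left_flip_bit)

text \<open>Comparing a mode of \<open>k\<close> with one of \<open>l\<close> gives opposite signs in the two orders; there are four
  such comparisons, so the signs cancel.\<close>

lemma pair_sign_flip_swap:
  assumes "k \<in> \<Lambda>" "l \<in> \<Lambda>" "k \<noteq> l"
  shows "pair_sign k (flip l j) * pair_sign l j = pair_sign l (flip k j) * pair_sign k j"
proof -
  define s :: "nat \<Rightarrow> nat \<Rightarrow> complex" where "s p q = (if q < p then - 1 else 1)" for p q
  have s: "s p q = - s q p" if "p \<noteq> q" for p q
    using that by (auto simp: s_def)
  have flip: "pair_sign k (flip l j) =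
      s (up k) (up l) * s (up k) (down l) * s (down k) (up l) * s (down k) (down l) * pair_sign k j" for k l
    unfolding pair_sign_def flip_def sign_occ_left_flip_bit s_def[symmetric] by simp
  have ne: "up k \<noteq> up l" "down k \<noteq> down l"
    using assms by (simp_all add: up_eq_iff down_eq_iff)
  show ?thesis
    unfolding flip s[OF ne(1)] s[OF ne(2)] s[OF up_neq_down(1)[of k l]] s[OF up_neq_down(2)[of k l]]
    by simp
qed

definition balanced :: "real ^ 3 \<Rightarrow> nat \<Rightarrow> bool" where
  "balanced k j \<longleftrightarrow> bit j (up k) = bit j (down k)"

definition pair_count :: "real ^ 3 \<Rightarrow> nat \<Rightarrow> nat" where
  "pair_count k j = of_bool (bit j (up k)) + of_bool (bit j (down k))"

text \<open>The amplitude of creation minus annihilation of the pair; both vanish on a singly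
  occupied pair.\<close>

definition gen_coeff :: "real ^ 3 \<Rightarrow> nat \<Rightarrow> complex" where
  "gen_coeff k j = (if balanced k j then pair_sign k j else 0)"

text \<open>The amplitude of creation plus annihilation: the extra sign on full pairs undoes the
  minus in front of annihilation in \<open>gen_coeff\<close>.\<close>

definition field_coeff :: "real ^ 3 \<Rightarrow> nat \<Rightarrow> complex" where
  "field_coeff k j = (if bit j (up k) then - 1 else 1) * gen_coeff k j"

lemma cnj_gen_coeff: "cnj (gen_coeff k j) = gen_coeff k j"
  by (simp add: gen_coeff_def pair_sign_def)

lemma cnj_field_coeff: "cnj (field_coeff k j) = field_coeff k j"
  by (simp add: field_coeff_def cnj_gen_coeff)

lemma bit_flip_other:
  assumes "k \<in> \<Lambda>" "l \<in> \<Lambda>" "k \<noteq> l"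
  shows "bit (flip l j) (up k) = bit j (up k)" "bit (flip l j) (down k) = bit j (down k)"
  using assms by (auto simp: bit_flip up_eq_iff down_eq_iff)

lemma pair_count_flip_other:
  "k \<in> \<Lambda> \<Longrightarrow> l \<in> \<Lambda> \<Longrightarrow> k \<noteq> l \<Longrightarrow> pair_count k (flip l j) = pair_count k j"
  by (simp add: pair_count_def bit_flip_other)

lemma gen_coeff_flip_swap:
  assumes "k \<in> \<Lambda>" "l \<in> \<Lambda>" "k \<noteq> l"
  shows "gen_coeff k (flip l j) * gen_coeff l j = gen_coeff l (flip k j) * gen_coeff k j"
  using pair_sign_flip_swap[OF assms] assms
  by (auto simp: gen_coeff_def balanced_def bit_flip_other)

lemma field_gen_coeff_flip_swap:
  assumes "k \<in> \<Lambda>" "l \<in> \<Lambda>" "k \<noteq> l"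
  shows "field_coeff k (flip l j) * gen_coeff l j = gen_coeff l (flip k j) * field_coeff k j"
  using gen_coeff_flip_swap[OF assms] assms
  by (simp add: field_coeff_def bit_flip_other)

text \<open>This is the antisymmetry of the generator, which makes its exponential
  orthogonal.\<close>

lemma gen_coeff_flip_self: "gen_coeff k (flip k j) = - gen_coeff k j"
  by (auto simp: gen_coeff_def balanced_def bit_flip pair_sign_flip_self)

text \<open>The sign from the antisymmetry cancels against the one from the changed occupation; the
  resulting symmetry makes the Hamiltonian selfadjoint.\<close>

lemma field_coeff_flip_self: "field_coeff k (flip k j) = field_coeff k j"
  by (auto simp: field_coeff_def gen_coeff_flip_self bit_flip)

lemma gen_coeff_square: "gen_coeff k j * gen_coeff k j = of_bool (balanced k j)"
  by (simp add: gen_coeff_def)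

section \<open>Matrix entries of the fermion operators\<close>

lemma annih_carrier [simp]: "annih \<Lambda> pos k s \<in> carrier_mat dH dH"
  by (simp add: annih_def Let_def)

lemma creat_carrier [simp]: "creat \<Lambda> pos k s \<in> carrier_mat dH dH"
  by (simp add: creat_def Let_def)

text \<open>On an occupied mode, unsetting the bit is flipping it. With \<open>flip_bit\<close> the
  same sign rule serves annihilation and creation.\<close>

lemma index_annih:
  "i < dH \<Longrightarrow> j < dH \<Longrightarrow> annih \<Lambda> pos k s $$ (i, j) =
    (if i = flip_bit (mode_pos pos k s) j
     then of_bool (bit j (mode_pos pos k s)) * (- 1) ^ occ_left (mode_pos pos k s) j else 0)"
  by (simp add: annih_def Let_def flip_bit_eq_if)

lemma index_creat:
  "i < dH \<Longrightarrow> j < dH \<Longrightarrow> creat \<Lambda> pos k s $$ (i, j) =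
    (if i = flip_bit (mode_pos pos k s) j
     then of_bool (\<not> bit j (mode_pos pos k s)) * (- 1) ^ occ_left (mode_pos pos k s) j else 0)"
  by (simp add: creat_def Let_def flip_bit_eq_if)

lemma pair_annih_carrier [simp]: "pair_annih \<Lambda> pos k \<in> carrier_mat dH dH"
  by (simp add: pair_annih_def mult_carrier_mat[of _ dH dH])

lemma pair_creat_carrier [simp]: "pair_creat \<Lambda> pos k \<in> carrier_mat dH dH"
  by (simp add: pair_creat_def mult_carrier_mat[of _ dH dH])

text \<open>Here the up mode is toggled first. Compared with the order in \<open>pair_sign\<close>,
  exactly one of the two orders picks up a sign, which accounts for the minus.\<close>

lemma index_pair_annih:
  assumes "k \<in> \<Lambda>" "i < dH" "j < dH"
  shows "pair_annih \<Lambda> pos k $$ (i, j) =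
    (if i = flip k j then - (of_bool (bit j (up k)) * gen_coeff k j) else 0)"
proof -
  have "pair_annih \<Lambda> pos k $$ (i, j) =
      annih \<Lambda> pos (- k) Down $$ (i, flip_bit (up k) j) * annih \<Lambda> pos k Up $$ (flip_bit (up k) j, j)"
    unfolding pair_annih_def index_mult_mat_sum[OF annih_carrier annih_carrier assms(2,3)]
    using assms flip_up_less
    by (intro sum_single) (auto simp: index_annih mode_pos_eq simp del: mode_pos.simps)
  then show ?thesis
    using assms flip_up_less up_neq_down(1)[of k k]
    by (auto simp: index_annih mode_pos_eq flip_def flip_bit_commute sign_occ_left_flip_bit
        gen_coeff_def balanced_def pair_sign_def bit_flip_bit_iff simp del: mode_pos.simps)
qed

lemma index_pair_creat:
  assumes "k \<in> \<Lambda>" "i < dH" "j < dH"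
  shows "pair_creat \<Lambda> pos k $$ (i, j) =
    (if i = flip k j then of_bool (\<not> bit j (up k)) * gen_coeff k j else 0)"
proof -
  have "pair_creat \<Lambda> pos k $$ (i, j) =
      creat \<Lambda> pos k Up $$ (i, flip_bit (down k) j) * creat \<Lambda> pos (- k) Down $$ (flip_bit (down k) j, j)"
    unfolding pair_creat_def index_mult_mat_sum[OF creat_carrier creat_carrier assms(2,3)]
    using assms flip_down_less
    by (intro sum_single) (auto simp: index_creat mode_pos_eq simp del: mode_pos.simps)
  then show ?thesis
    using assms flip_down_less up_neq_down(1)[of k k]
    by (auto simp: index_creat mode_pos_eq flip_def sign_occ_left_flip_bit
        gen_coeff_def balanced_def pair_sign_def bit_flip_bit_iff simp del: mode_pos.simps)
qed

text \<open>Removing and restoring a mode gives the same sign twice, since its own bit is not to its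
  left.\<close>

lemma index_number:
  assumes "mode_pos pos k s < 2 * card \<Lambda>" "i < dH" "j < dH"
  shows "(creat \<Lambda> pos k s * annih \<Lambda> pos k s) $$ (i, j) =
    (if i = j then of_bool (bit j (mode_pos pos k s)) else 0)"
proof -
  let ?p = "mode_pos pos k s"
  have less: "flip_bit ?p j < dH"
    using assms unfolding dimH_def by (intro flip_bit_less_power)
  have "(creat \<Lambda> pos k s * annih \<Lambda> pos k s) $$ (i, j) =
      creat \<Lambda> pos k s $$ (i, flip_bit ?p j) * annih \<Lambda> pos k s $$ (flip_bit ?p j, j)"
    unfolding index_mult_mat_sum[OF creat_carrier annih_carrier assms(2,3)]
    using assms less
    by (intro sum_single) (auto simp: index_annih)
  then show ?thesis
    using assms less
    by (auto simp: index_annih index_creat sign_occ_left_flip_bit bit_flip_bit_iff simp flip: power_add)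
qed

section \<open>Rotation and diagonalisation of a single pair\<close>

definition pair_gen :: "real ^ 3 \<Rightarrow> complex Matrix.mat" where
  "pair_gen k = invol_mat dH (flip k) (\<lambda>_. 0) (gen_coeff k)"

lemma pair_gen_carrier [simp]: "pair_gen k \<in> carrier_mat dH dH"
  by (simp add: pair_gen_def)

lemma pair_gen_eq: "k \<in> \<Lambda> \<Longrightarrow> pair_creat \<Lambda> pos k - pair_annih \<Lambda> pos k = pair_gen k"
  by (intro eq_matI) (auto simp: pair_gen_def index_invol_mat index_pair_annih index_pair_creat
      carrier_matD[OF pair_annih_carrier])

lemma pair_gen_square:
  assumes "k \<in> \<Lambda>"
  shows "pair_gen k * pair_gen k = invol_mat dH (flip k) (\<lambda>j. - of_bool (balanced k j)) (\<lambda>_. 0)"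
  unfolding pair_gen_def using assms
  by (subst mult_invol_mat) (auto simp: flip_less gen_coeff_flip_self gen_coeff_square)

text \<open>The square is minus the projection onto the balanced states, outside of which the
  generator vanishes.\<close>

lemma pair_gen_cube:
  assumes "k \<in> \<Lambda>"
  shows "pair_gen k * pair_gen k * pair_gen k = - pair_gen k"
  unfolding pair_gen_square[OF assms] unfolding pair_gen_def using assms
  by (subst mult_invol_mat)
    (auto simp: flip_less gen_coeff_def balanced_def bit_flip index_invol_mat intro!: eq_matI)

lemma mat_exp_pair_gen:
  assumes "k \<in> \<Lambda>"
  shows "mat_exp (complex_of_real t \<cdot>\<^sub>m pair_gen k) = invol_mat dH (flip k)
    (\<lambda>j. if balanced k j then of_real (cos t) else 1) (\<lambda>j. of_real (sin t) * gen_coeff k j)"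
  unfolding mat_exp_cube_eq_uminus[OF pair_gen_carrier pair_gen_cube[OF assms]] pair_gen_square[OF assms]
  unfolding pair_gen_def by (intro eq_matI) (auto simp: index_invol_mat)

definition pair_ham :: "real \<Rightarrow> real \<Rightarrow> real ^ 3 \<Rightarrow> complex Matrix.mat" where
  "pair_ham x D k = invol_mat dH (flip k)
     (\<lambda>j. of_real x * of_nat (pair_count k j)) (\<lambda>j. - of_real D * field_coeff k j)"

text \<open>The values are \<open>x - E\<close> for an empty pair, \<open>x\<close> for a singly
  occupied one and \<open>x + E\<close> for a full one. The form with zero moving amplitude makes
  the product rules for \<open>invol_mat\<close> applicable.\<close>

definition pair_diag :: "real \<Rightarrow> real \<Rightarrow> real ^ 3 \<Rightarrow> complex Matrix.mat" where
  "pair_diag x E k = invol_mat dH (flip k)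
     (\<lambda>j. of_real (x - E + E * of_nat (pair_count k j))) (\<lambda>_. 0)"

lemma pair_ham_carrier [simp]: "pair_ham x D k \<in> carrier_mat dH dH"
  by (simp add: pair_ham_def)

lemma pair_diag_carrier [simp]: "pair_diag x D k \<in> carrier_mat dH dH"
  by (simp add: pair_diag_def)

text \<open>Diagonal amplitudes of one pair ignore flips of another, and for the moving amplitudes
  the signs agree in both orders because each pair has two modes.\<close>

lemma pair_gen_commute:
  assumes "k \<in> \<Lambda>" "l \<in> \<Lambda>" "k \<noteq> l"
  shows "pair_gen k * pair_gen l = pair_gen l * pair_gen k"
    "pair_ham x D k * pair_gen l = pair_gen l * pair_ham x D k"
    "pair_diag x E k * pair_gen l = pair_gen l * pair_diag x E k"
  unfolding pair_gen_def pair_ham_def pair_diag_def using assms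
  by (intro invol_mat_commute;
      simp add: flip_less flip_commute pair_count_flip_other gen_coeff_flip_swap field_gen_coeff_flip_swap)+

text \<open>On the plane of empty and full pair the operator has diagonal 0, \<open>2 * x\<close>
  and off-diagonal entries \<open>D\<close> up to sign; rotation by half the polar angle of
  \<open>(x, D)\<close> diagonalises it. Singly occupied pairs have the value \<open>x\<close> on
  both sides.\<close>

lemma pair_ham_intertwine:
  assumes k: "k \<in> \<Lambda>" and D: "D = E * sin (2 * t)" and x: "x = E * cos (2 * t)"
  shows "pair_ham x D k * mat_exp (complex_of_real t \<cdot>\<^sub>m pair_gen k) =
    mat_exp (complex_of_real t \<cdot>\<^sub>m pair_gen k) * pair_diag x E k"
proof -
  have c: "cos t * (cos t * y) = y - sin t * (sin t * y)" for y
    using cos_squared_eq[of t] by (simp add: power2_eq_square mult.assoc[symmetric] left_diff_distrib)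
  \<comment> \<open>These are the eigenvalue equations of the rotated basis vectors; the same two
    serve both eigenvectors.\<close>
  have "D * sin t = cos t * (E - x)" "D * cos t = sin t * (x + E)"
    unfolding D x sin_double cos_double by (simp_all add: algebra_simps power2_eq_square c)
  from this[THEN arg_cong[of _ _ complex_of_real]]
  have amplitudes: "of_real D * of_real (sin t) = (of_real (cos t) * (of_real E - of_real x) :: complex)"
     "of_real D * of_real (cos t) = (of_real (sin t) * (of_real x + of_real E) :: complex)"
    by simp_all
  \<comment> \<open>The trailing factor \<open>y\<close> lets the identities rewrite inside longer
    products that carry a sign.\<close>
  have amp: "of_real D * (of_real (sin t) * y) = (of_real (cos t) * (of_real E - of_real x) * y :: complex)"
     "of_real D * (of_real (cos t) * y) = (of_real (sin t) * (of_real x + of_real E) * y :: complex)" for y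
    using amplitudes by (simp_all only: mult.assoc[symmetric])
  have prod: "invol_mat dH (flip k) a b * invol_mat dH (flip k) c d =
      invol_mat dH (flip k) (\<lambda>j. a j * c j + b (flip k j) * d j) (\<lambda>j. b j * c j + a (flip k j) * d j)"
    for a b c d :: "nat \<Rightarrow> complex"
    by (rule mult_invol_mat) (simp_all add: flip_less k)
  show ?thesis
    unfolding pair_ham_def pair_diag_def mat_exp_pair_gen[OF k]
      prod
  proof (intro arg_cong2[where f = "invol_mat dH (flip k)"] ext)
    fix j
    show "of_real x * of_nat (pair_count k j) * (if balanced k j then of_real (cos t) else 1)
        + - of_real D * field_coeff k (flip k j) * (of_real (sin t) * gen_coeff k j)
      = (if balanced k j then of_real (cos t) else 1) * of_real (x - E + E * of_nat (pair_count k j))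
        + of_real (sin t) * gen_coeff k (flip k j) * 0"
      unfolding field_coeff_flip_self
      by (cases "bit j (up k)"; cases "bit j (down k)")
        (simp_all add: field_coeff_def gen_coeff_def balanced_def pair_count_def
          algebra_simps amp amplitudes)
    show "- of_real D * field_coeff k j * (if balanced k j then of_real (cos t) else 1)
        + of_real x * of_nat (pair_count k (flip k j)) * (of_real (sin t) * gen_coeff k j)
      = of_real (sin t) * gen_coeff k j * of_real (x - E + E * of_nat (pair_count k j))
        + (if balanced k (flip k j) then of_real (cos t) else 1) * 0"
      by (cases "bit j (up k)"; cases "bit j (down k)")
        (simp_all add: field_coeff_def gen_coeff_def balanced_def pair_count_def bit_flip
          algebra_simps amp)
  qed
qed

end


section \<open>The mean field Hamiltonian\<close>

text \<open>The conditions on \<theta> are put in polar form, with \<open>E\<close> standing for the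
  square root of the sum of squares.\<close>

locale mean_field = momentum_modes +
  fixes \<xi> \<Delta> \<theta> E :: "real ^ 3 \<Rightarrow> real"
  assumes even: "k \<in> \<Lambda> \<Longrightarrow> \<xi> (- k) = \<xi> k"
    and E_pos: "k \<in> \<Lambda> \<Longrightarrow> E k > 0"
    and \<Delta>_eq: "k \<in> \<Lambda> \<Longrightarrow> \<Delta> k = E k * sin (2 * \<theta> k)"
    and \<xi>_eq: "k \<in> \<Lambda> \<Longrightarrow> \<xi> k = E k * cos (2 * \<theta> k)"
begin

abbreviation "H \<equiv> H_M \<Lambda> pos \<xi> \<Delta> \<theta>"
abbreviation "\<Psi> \<equiv> BCS_state \<Lambda> pos \<theta>"
abbreviation "generator \<equiv> mat_sum dH (\<lambda>k. complex_of_real (\<theta> k) \<cdot>\<^sub>m pair_gen k) \<Lambda>"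
abbreviation "U \<equiv> mat_exp generator"
abbreviation "V \<equiv> mat_exp (- generator)"
abbreviation "offset \<equiv> (\<Sum>k\<in>\<Lambda>. complex_of_real (\<Delta> k) * pair_expect \<Lambda> pos \<theta> k)"

lemma U_carrier [simp]: "U \<in> carrier_mat dH dH" "V \<in> carrier_mat dH dH"
  by simp_all

text \<open>The two imaginary units multiply to -1, which turns annihilation minus creation into the
  opposite difference.\<close>

lemma generator_eq: "\<i> \<cdot>\<^sub>m G_B \<Lambda> pos \<theta> = generator"
proof -
  have "op_sum \<Lambda> (\<lambda>k. complex_of_real (\<theta> k) \<cdot>\<^sub>m (pair_annih \<Lambda> pos k - pair_creat \<Lambda> pos k)) \<Lambda>
    = mat_sum dH (\<lambda>k. complex_of_real (\<theta> k) \<cdot>\<^sub>m (pair_annih \<Lambda> pos k - pair_creat \<Lambda> pos k)) \<Lambda>"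
    using finite by (intro finsum_module_mat) (auto simp: minus_carrier_mat)
  then show ?thesis
    unfolding G_B_def
    by (auto simp: pair_gen_eq[symmetric] carrier_matD[OF pair_annih_carrier]
        carrier_matD[OF pair_creat_carrier] sum_negf[symmetric] right_diff_distrib intro!: eq_matI sum.cong)
qed

lemma BCS_state_eq: "\<Psi> = U *\<^sub>v unit_vec dH 0"
  by (simp add: BCS_state_def generator_eq vacuum_def)

lemma dH_pos: "0 < dH"
  by (simp add: dimH_def)

lemma index_kinetic:
  assumes "i < dH" "j < dH"
  shows "(\<Sum>(k, s)\<in>\<Lambda> \<times> {Up, Down}. complex_of_real (\<xi> k) * (creat \<Lambda> pos k s * annih \<Lambda> pos k s) $$ (i, j)) =
    (if i = j then \<Sum>k\<in>\<Lambda>. of_real (\<xi> k) * of_nat (pair_count k j) else 0)"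
proof -
  let ?n = "\<lambda>k s. (creat \<Lambda> pos k s * annih \<Lambda> pos k s) $$ (i, j)"
  \<comment> \<open>Since \<xi> is even, the spin-down modes may be relabelled by
    \<open>- k\<close>, so that both modes of a pair carry the same index.\<close>
  have "(\<Sum>k\<in>\<Lambda>. complex_of_real (\<xi> k) * ?n k Down) = (\<Sum>k\<in>\<Lambda>. complex_of_real (\<xi> k) * ?n (- k) Down)"
    using even uminus_mem
    by (intro sum.reindex_bij_witness[of _ uminus uminus]) auto
  then have "(\<Sum>(k, s)\<in>\<Lambda> \<times> {Up, Down}. complex_of_real (\<xi> k) * ?n k s) =
      (\<Sum>k\<in>\<Lambda>. complex_of_real (\<xi> k) * (?n k Up + ?n (- k) Down))"
    by (simp add: sum.cartesian_product[symmetric] sum.distrib distrib_left)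
  also have "\<dots> = (if i = j then \<Sum>k\<in>\<Lambda>. of_real (\<xi> k) * of_nat (pair_count k j) else 0)"
    using assms
    by (auto simp: index_number mode_pos_eq up_less down_less pair_count_def
        simp del: mode_pos.simps index_mult_mat intro!: sum.cong)
  finally show ?thesis .
qed

lemma H_eq: "H = mat_sum dH (\<lambda>k. pair_ham (\<xi> k) (\<Delta> k) k) \<Lambda> + offset \<cdot>\<^sub>m 1\<^sub>m dH"
proof -
  have 1: "op_sum \<Lambda> (\<lambda>(k, s). complex_of_real (\<xi> k) \<cdot>\<^sub>m (creat \<Lambda> pos k s * annih \<Lambda> pos k s)) (\<Lambda> \<times> {Up, Down})
    = mat_sum dH (\<lambda>(k, s). complex_of_real (\<xi> k) \<cdot>\<^sub>m (creat \<Lambda> pos k s * annih \<Lambda> pos k s)) (\<Lambda> \<times> {Up, Down})"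
    using finite by (intro finsum_module_mat) (auto simp: mult_carrier_mat[of _ dH dH])
  have 2: "op_sum \<Lambda> (\<lambda>k. complex_of_real (\<Delta> k) \<cdot>\<^sub>m (pair_annih \<Lambda> pos k + pair_creat \<Lambda> pos k)) \<Lambda>
    = mat_sum dH (\<lambda>k. complex_of_real (\<Delta> k) \<cdot>\<^sub>m (pair_annih \<Lambda> pos k + pair_creat \<Lambda> pos k)) \<Lambda>"
    using finite by (intro finsum_module_mat) auto
  have 3: "mat_sum dH (\<lambda>(k, s). complex_of_real (\<xi> k) \<cdot>\<^sub>m (creat \<Lambda> pos k s * annih \<Lambda> pos k s)) (\<Lambda> \<times> {Up, Down})
    - mat_sum dH (\<lambda>k. complex_of_real (\<Delta> k) \<cdot>\<^sub>m (pair_annih \<Lambda> pos k + pair_creat \<Lambda> pos k)) \<Lambda>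
    = mat_sum dH (\<lambda>k. pair_ham (\<xi> k) (\<Delta> k) k) \<Lambda>" (is "?l = ?r")
  proof (rule eq_matI)
    fix i j assume "i < dim_row ?r" "j < dim_col ?r"
    then have ij: "i < dH" "j < dH" by simp_all
    have "(\<Sum>x\<in>\<Lambda> \<times> {Up, Down}. (case x of (k, s) \<Rightarrow>
          complex_of_real (\<xi> k) \<cdot>\<^sub>m (creat \<Lambda> pos k s * annih \<Lambda> pos k s)) $$ (i, j)) =
        (\<Sum>(k, s)\<in>\<Lambda> \<times> {Up, Down}. complex_of_real (\<xi> k) * (creat \<Lambda> pos k s * annih \<Lambda> pos k s) $$ (i, j))"
      using ij by (intro sum.cong) (auto simp del: index_mult_mat(1)
        simp: carrier_matD[OF creat_carrier] carrier_matD[OF annih_carrier])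
    then show "?l $$ (i, j) = ?r $$ (i, j)"
      using ij unfolding pair_ham_def
      by (auto simp: index_kinetic index_invol_mat index_pair_annih index_pair_creat field_coeff_def
        carrier_matD[OF pair_annih_carrier] carrier_matD[OF pair_creat_carrier]
        sum_subtractf[symmetric] sum_negf[symmetric] simp del: index_mult_mat(1) intro!: sum.cong)
  qed simp_all
  show ?thesis
    unfolding H_M_def 1 2 3 ..
qed

lemma H_carrier [simp]: "H \<in> carrier_mat dH dH"
  by (simp add: H_eq)

definition level :: "nat \<Rightarrow> complex" where
  "level j = of_real (\<Sum>k\<in>\<Lambda>. \<xi> k - E k + E k * real (pair_count k j)) + offset"

text \<open>\<open>mat_sum_exp_intertwine\<close> lifts the rotation of single pairs to all pairs;
  the constant \<open>offset\<close> multiplies the identity and passes through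
  \<open>U\<close>.\<close>

lemma HU: "H * U = U * mat_diag dH level"
proof -
  let ?h = "mat_sum dH (\<lambda>k. pair_ham (\<xi> k) (\<Delta> k) k) \<Lambda>"
  let ?d = "mat_sum dH (\<lambda>k. pair_diag (\<xi> k) (E k) k) \<Lambda>"
  have comm: "X * (complex_of_real t \<cdot>\<^sub>m pair_gen l) = complex_of_real t \<cdot>\<^sub>m pair_gen l * X"
    if "X * pair_gen l = pair_gen l * X" "X \<in> carrier_mat dH dH" for X t l
    using that by (simp add: mult_smult_assoc_mat[of _ dH dH _ dH] mult_smult_distrib[of _ dH dH _ dH])
  have "?h * U = U * ?d"
    using finite \<Delta>_eq \<xi>_eq
    by (intro mat_sum_exp_intertwine comm comm[symmetric] pair_gen_commute pair_gen_commute[symmetric]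
        pair_ham_intertwine) auto
  moreover have "mat_diag dH level = ?d + offset \<cdot>\<^sub>m 1\<^sub>m dH"
    by (auto simp: mat_diag_def level_def pair_diag_def index_invol_mat intro!: eq_matI)
  ultimately show ?thesis
    unfolding H_eq using U_carrier
    by (simp add: add_mult_distrib_mat[of _ dH dH _ _ dH] mult_add_distrib_mat[of _ dH dH _ dH]
        mult_smult_assoc_mat[of _ dH dH _ dH] mult_smult_distrib[of _ dH dH _ dH]
        left_mult_one_mat[of _ dH dH] right_mult_one_mat[of _ dH dH])
qed

sublocale diagonalised dH H U V level
  by unfold_locales (simp_all add: mat_exp_minus[of _ dH] HU)

section \<open>Reality, normalisation and selfadjointness\<close>

lemma index_U_Reals: "i < dH \<Longrightarrow> j < dH \<Longrightarrow> U $$ (i, j) \<in> \<real>"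
  by (rule mat_exp_Reals[of _ dH])
    (auto simp: pair_gen_def index_invol_mat Reals_cnj_iff cnj_gen_coeff if_distrib[of cnj] cong: if_cong)

lemma cnj_U: "i < dH \<Longrightarrow> j < dH \<Longrightarrow> cnj (U $$ (i, j)) = U $$ (i, j)"
  using index_U_Reals by (simp add: Reals_cnj_iff)

lemma transpose_U: "transpose_mat U = V"
proof -
  have "transpose_mat generator = - generator"
    by (auto simp: pair_gen_def index_invol_mat sum_negf[symmetric] gen_coeff_flip_self
        intro!: eq_matI sum.cong)
  then show ?thesis by (simp add: transpose_mat_exp[of _ dH])
qed

lemma index_BCS_state: "i < dH \<Longrightarrow> \<Psi> $ i = U $$ (i, 0)"
  unfolding BCS_state_eq using dH_pos carrier_matD[OF U_carrier(1)]
  by (simp add: mult_unit_vec[of _ dH])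

lemma BCS_state_carrier: "\<Psi> \<in> carrier_vec dH"
  unfolding BCS_state_eq by (rule mult_mat_vec_carrier[of _ dH dH]) simp_all

lemma cnj_BCS_state: "i < dH \<Longrightarrow> cnj (\<Psi> $ i) = \<Psi> $ i"
  using dH_pos by (simp add: index_BCS_state cnj_U)

text \<open>As \<open>U\<close> is real with transpose \<open>V\<close>, the squared norm of its
  vacuum column is the corresponding diagonal entry of \<open>V * U\<close>.\<close>

lemma BCS_state_normalised: "inner_prod \<Psi> \<Psi> = 1"
proof -
  have "inner_prod \<Psi> \<Psi> = (\<Sum>i<dH. V $$ (0, i) * U $$ (i, 0))"
    using BCS_state_carrier dH_pos carrier_matD[OF U_carrier(1)] unfolding transpose_U[symmetric]
    by (auto simp: inner_prod_def scalar_prod_def atLeast0LessThan cnj_U index_BCS_state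
        intro!: sum.cong)
  also have "\<dots> = (V * U) $$ (0, 0)"
    using dH_pos by (simp only: index_mult_mat_sum[of _ dH] U_carrier)
  finally show ?thesis using inverse dH_pos by simp
qed

text \<open>State and operator have real entries. This makes the constant in the Hamiltonian
  real.\<close>

lemma pair_expect_Reals:
  assumes "k \<in> \<Lambda>"
  shows "pair_expect \<Lambda> pos \<theta> k \<in> \<real>"
proof -
  have "cnj (pair_annih \<Lambda> pos k $$ (i, j)) = pair_annih \<Lambda> pos k $$ (i, j)" if "i < dH" "j < dH" for i j
    using that assms by (simp add: index_pair_annih cnj_gen_coeff)
  then have "cnj (pair_expect \<Lambda> pos \<theta> k) = pair_expect \<Lambda> pos \<theta> k"
    using BCS_state_carrier carrier_matD[OF pair_annih_carrier[of k]]
    by (auto simp: pair_expect_def inner_prod_def scalar_prod_def cnj_BCS_state intro!: sum.cong)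
  then show ?thesis by (simp add: Reals_cnj_iff)
qed

lemma offset_Reals: "offset \<in> \<real>"
  by (intro sum_in_Reals Reals_mult pair_expect_Reals) auto

lemma H_selfadjoint: "selfadjoint H"
proof (rule selfadjointI[OF H_carrier])
  fix i j assume ij: "i < dH" "j < dH"
  have "cnj (pair_ham (\<xi> k) (\<Delta> k) k $$ (j, i)) = pair_ham (\<xi> k) (\<Delta> k) k $$ (i, j)" for k
    using ij
    by (auto simp: pair_ham_def index_invol_mat field_coeff_flip_self cnj_field_coeff)
  then show "cnj (H $$ (j, i)) = H $$ (i, j)"
    using ij offset_Reals unfolding H_eq by (simp add: Reals_cnj_iff)
qed

section \<open>Energy levels and the ground state\<close>

definition excitation :: "nat \<Rightarrow> real" where
  "excitation j = (\<Sum>k\<in>\<Lambda>. E k * real (pair_count k j))"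

definition E0 :: complex where
  "E0 = (\<Sum>k\<in>\<Lambda>. complex_of_real (\<xi> k - E k) + complex_of_real (\<Delta> k) * pair_expect \<Lambda> pos \<theta> k)"

lemma level_eq: "level j = of_real (excitation j) + E0"
  by (simp add: level_def excitation_def E0_def sum.distrib)

lemma E0_Reals: "E0 \<in> \<real>"
  unfolding E0_def by (intro sum_in_Reals Reals_add Reals_mult pair_expect_Reals) auto

lemma excitation_0: "excitation 0 = 0"
  by (simp add: excitation_def pair_count_def)

lemma excitation_nonneg: "0 \<le> excitation j"
  unfolding excitation_def using E_pos by (intro sum_nonneg mult_nonneg_nonneg) (auto intro: less_imp_le)

lemma mode_cases:
  assumes "r < 2 * card \<Lambda>"
  obtains k where "k \<in> \<Lambda>" "r = up k \<or> r = down k"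
proof -
  have "r div 2 < card \<Lambda>" using assms by simp
  then have "r div 2 \<in> pos ` \<Lambda>" using pos by (simp add: bij_betw_def)
  then obtain k where k: "k \<in> \<Lambda>" "pos k = r div 2" by fastforce
  have "r = 2 * (r div 2) \<or> r = 2 * (r div 2) + 1" by presburger
  \<comment> \<open>An odd position is a spin-down mode, which belongs to the pair labelled by the
    opposite momentum.\<close>
  then have "r = up k \<or> r = down (- k)"
    by (simp add: up_def down_def k)
  then show thesis using that k uminus_mem[of k] that[of "- k"] by blast
qed

text \<open>A nonzero index has some bit set, every bit within range belongs to a pair, and that
  pair contributes a positive energy. So only the vacuum attains the minimum.\<close>

lemma excitation_pos:
  assumes "j < dH" "j \<noteq> 0"
  shows "0 < excitation j"
proof -
  obtain r where r: "bit j r" using assms(2) by (auto simp: bit_eq_iff)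
  have "r < 2 * card \<Lambda>"
  proof (rule ccontr)
    assume "\<not> r < 2 * card \<Lambda>"
    then have "\<not> bit (take_bit (2 * card \<Lambda>) j) r" by (simp add: bit_take_bit_iff)
    with r assms(1) show False by (simp add: dimH_def take_bit_nat_eq_self)
  qed
  then obtain k where k: "k \<in> \<Lambda>" "r = up k \<or> r = down k" by (rule mode_cases)
  then have "0 < pair_count k j" using r by (auto simp: pair_count_def)
  then show ?thesis
    unfolding excitation_def using finite k(1) E_pos
    by (intro sum_pos2[of _ k] mult_nonneg_nonneg mult_pos_pos) (simp_all add: less_imp_le)
qed

lemma occupation_exists:
  obtains j where "j < dH" "\<And>k. k \<in> \<Lambda> \<Longrightarrow> bit j (up k) = P k" "\<And>k. k \<in> \<Lambda> \<Longrightarrow> bit j (down k) = Q k"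
proof
  let ?inv = "inv_into \<Lambda> pos"
  \<comment> \<open>The binary digits of \<open>j\<close> are prescribed. An odd position carries
    the momentum of the down mode itself, hence the minus that recovers its pair label.\<close>
  let ?bs = "map (\<lambda>r. if even r then P (?inv (r div 2)) else Q (- ?inv (r div 2))) [0..<2 * card \<Lambda>]"
  let ?j = "horner_sum of_bool 2 ?bs :: nat"
  have inj: "inj_on pos \<Lambda>" using pos by (simp add: bij_betw_def)
  show "?j < dH" using horner_sum_of_bool_2_less[of ?bs] by (simp add: dimH_def)
  show "bit ?j (up k) = P k" if "k \<in> \<Lambda>" for k
    using that up_less[of k] by (simp add: bit_horner_sum_bit_iff up_def inv_into_f_f[OF inj])
  show "bit ?j (down k) = Q k" if "k \<in> \<Lambda>" for k
    using that down_less[of k] by (simp add: bit_horner_sum_bit_iff down_def inv_into_f_f[OF inj] uminus_mem)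
qed

lemma spectrum_H:
  "spectrum H = {complex_of_real (\<Sum>k\<in>\<Lambda>. E k * (real (N k Up) + real (N k Down))) + E0 |
     N :: real ^ 3 \<Rightarrow> spin \<Rightarrow> nat. \<forall>k\<in>\<Lambda>. N k Up \<in> {0, 1} \<and> N k Down \<in> {0, 1}}"
  (is "_ = ?R")
proof
  show "spectrum H \<subseteq> ?R"
  proof
    fix e assume "e \<in> spectrum H"
    then obtain j where j: "e = level j" by (auto simp: spectrum)
    \<comment> \<open>\<open>N k Down\<close> is the occupation of the down mode in pair
      \<open>k\<close>, whose momentum is \<open>- k\<close>.\<close>
    define N :: "real ^ 3 \<Rightarrow> spin \<Rightarrow> nat" where
      "N k s = of_bool (bit j (case s of Up \<Rightarrow> up k | Down \<Rightarrow> down k))" for k s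
    have "e = complex_of_real (\<Sum>k\<in>\<Lambda>. E k * (real (N k Up) + real (N k Down))) + E0"
      by (simp add: j level_eq excitation_def pair_count_def N_def)
    moreover have "\<forall>k\<in>\<Lambda>. N k Up \<in> {0, 1} \<and> N k Down \<in> {0, 1}"
      by (simp add: N_def)
    ultimately show "e \<in> ?R" by blast
  qed
  show "?R \<subseteq> spectrum H"
  proof
    fix e assume "e \<in> ?R"
    then obtain N :: "real ^ 3 \<Rightarrow> spin \<Rightarrow> nat"
      where e: "e = complex_of_real (\<Sum>k\<in>\<Lambda>. E k * (real (N k Up) + real (N k Down))) + E0"
        and N: "\<forall>k\<in>\<Lambda>. N k Up \<in> {0, 1} \<and> N k Down \<in> {0, 1}"
      by blast
    obtain j where j: "j < dH" "\<And>k. k \<in> \<Lambda> \<Longrightarrow> bit j (up k) = (N k Up = 1)"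
        "\<And>k. k \<in> \<Lambda> \<Longrightarrow> bit j (down k) = (N k Down = 1)"
      using occupation_exists[of "\<lambda>k. N k Up = 1" "\<lambda>k. N k Down = 1"] by blast
    have "excitation j = (\<Sum>k\<in>\<Lambda>. E k * (real (N k Up) + real (N k Down)))"
      unfolding excitation_def pair_count_def using N by (intro sum.cong) (auto simp: j)
    then have "e = level j" by (simp add: e level_eq)
    then show "e \<in> spectrum H" using j(1) by (auto simp: spectrum)
  qed
qed

text \<open>Excitations are nonnegative and vanish at index 0; since \<open>E0\<close> is real,
  taking real parts loses nothing.\<close>

lemma ground_energy: "complex_of_real (ground_state_energy H) = level 0"
proof -
  have "Re (level 0) \<in> Re ` level ` {..<dH}" using dH_pos by blast
  then have "ground_state_energy H = Re (level 0)"
    unfolding ground_state_energy_def spectrum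
    using excitation_nonneg by (intro Min_eqI) (auto simp: level_eq excitation_0)
  then show ?thesis using E0_Reals by (simp add: level_eq excitation_0)
qed

lemma ground_state_BCS: "ground_state H \<Psi>"
  unfolding ground_state_def ground_energy
  using H_selfadjoint BCS_state_normalised eigenvector_col[OF dH_pos] by (simp add: BCS_state_eq)

text \<open>The lowest level occurs only at the vacuum, so the eigenvector is a multiple of the BCS
  state, and normalisation fixes the modulus of the factor.\<close>

lemma ground_state_unique:
  assumes "ground_state H \<Phi>"
  shows "\<exists>c. cmod c = 1 \<and> \<Phi> = c \<cdot>\<^sub>v \<Psi>"
proof -
  have ev: "eigenvector H \<Phi> (level 0)" and norm: "inner_prod \<Phi> \<Phi> = 1"
    using assms by (auto simp: ground_state_def ground_energy)
  have "level i \<noteq> level 0" if "i < dH" "i \<noteq> 0" for i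
    using excitation_pos[OF that] by (simp add: level_eq excitation_0)
  then obtain c where c: "\<Phi> = c \<cdot>\<^sub>v \<Psi>"
    using simple_eigenvector[OF ev dH_pos] by (auto simp: BCS_state_eq)
  have "inner_prod \<Phi> \<Phi> = c * cnj c * inner_prod \<Psi> \<Psi>"
    by (simp add: c inner_prod_def scalar_prod_def sum_distrib_left mult_ac)
  then have "c * cnj c = 1" using norm BCS_state_normalised by simp
  then have "(cmod c)\<^sup>2 = 1" by (simp add: complex_norm_square[symmetric] flip: of_real_power)
  then have "cmod c = 1" by (simp add: power2_eq_1_iff) (use norm_ge_zero[of c] in linarith)
  with c show ?thesis by blast
qed

end

section \<open>The lattice momenta and the final assembly\<close>

lemma momenta_uminus:
  assumes "k \<in> momenta L K"
  shows "- k \<in> momenta L K"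
proof -
  obtain n1 n2 n3 :: int where
    k: "k = (2 * pi / L) *\<^sub>R vector [of_int n1, of_int n2, of_int n3]"
    and le: "(2 * pi / L) * sqrt ((of_int n1)\<^sup>2 + (of_int n2)\<^sup>2 + (of_int n3)\<^sup>2) \<le> K"
    using assms by (auto simp: momenta_def)
  have "- k = (2 * pi / L) *\<^sub>R vector [of_int (- n1), of_int (- n2), of_int (- n3)]"
    unfolding k by (simp add: Finite_Cartesian_Product.vec_eq_iff forall_3 vector_3)
  moreover have "(2 * pi / L) * sqrt ((of_int (- n1))\<^sup>2 + (of_int (- n2))\<^sup>2 + (of_int (- n3))\<^sup>2) \<le> K"
    using le by simp
  ultimately show ?thesis unfolding momenta_def by blast
qed

theorem corollary3p8:
  fixes L Kmax m \<mu> hbar :: real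
    and \<Lambda> :: "(real ^ 3) set"
    and pos :: "real ^ 3 \<Rightarrow> nat"
    and U :: "real ^ 3 \<Rightarrow> real ^ 3 \<Rightarrow> real"
    and \<xi> \<Delta> \<theta> :: "real ^ 3 \<Rightarrow> real"
  assumes "L > 0" and "Kmax > 0"
    and "\<Lambda> = momenta L Kmax"
    and "bij_betw pos \<Lambda> {..<card \<Lambda>}"
    and "m > 0" and "\<mu> > 0" and "hbar > 0"
    and "\<xi> = kinetic hbar m \<mu>"
    and "\<And>k k'. k \<in> \<Lambda> \<Longrightarrow> k' \<in> \<Lambda> \<Longrightarrow> U k k' \<le> 0"
    and "\<And>k k'. k \<in> \<Lambda> \<Longrightarrow> k' \<in> \<Lambda> \<Longrightarrow> U k' k = U k k'"
    and "\<And>k k'. k \<in> \<Lambda> \<Longrightarrow> k' \<in> \<Lambda> \<Longrightarrow> U (- k) (- k') = U k k'"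
    and "\<And>k. k \<in> \<Lambda> \<Longrightarrow> U k k = 0"
    and "\<And>k. k \<in> \<Lambda> \<Longrightarrow> \<Delta> k \<ge> 0"
    and "\<And>k. k \<in> \<Lambda> \<Longrightarrow> \<Delta> (- k) = \<Delta> k"
    and "\<And>k. k \<in> \<Lambda> \<Longrightarrow> (\<xi> k)\<^sup>2 + (\<Delta> k)\<^sup>2 > 0"
    and gap: "\<And>k. k \<in> \<Lambda> \<Longrightarrow>
      \<Delta> k = - (1 / 2) * (\<Sum>k'\<in>\<Lambda>. U k k' * \<Delta> k' / sqrt ((\<xi> k')\<^sup>2 + (\<Delta> k')\<^sup>2))"
    and "\<And>k. k \<in> \<Lambda> \<Longrightarrow> 0 \<le> \<theta> k \<and> \<theta> k \<le> pi / 2"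
    and "\<And>k. k \<in> \<Lambda> \<Longrightarrow> sin (2 * \<theta> k) = \<Delta> k / sqrt ((\<xi> k)\<^sup>2 + (\<Delta> k)\<^sup>2)"
    and "\<And>k. k \<in> \<Lambda> \<Longrightarrow> cos (2 * \<theta> k) = \<xi> k / sqrt ((\<xi> k)\<^sup>2 + (\<Delta> k)\<^sup>2)"
  shows
    "ground_state (H_M \<Lambda> pos \<xi> \<Delta> \<theta>) (BCS_state \<Lambda> pos \<theta>) \<and>
     (\<forall>\<Phi>. ground_state (H_M \<Lambda> pos \<xi> \<Delta> \<theta>) \<Phi> \<longrightarrow>
        (\<exists>c. cmod c = 1 \<and> \<Phi> = c \<cdot>\<^sub>v BCS_state \<Lambda> pos \<theta>)) \<and>
     complex_of_real (ground_state_energy (H_M \<Lambda> pos \<xi> \<Delta> \<theta>)) = E_BCS \<Lambda> pos \<xi> \<Delta> \<theta> \<and>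
     spectrum (H_M \<Lambda> pos \<xi> \<Delta> \<theta>) =
       {complex_of_real (\<Sum>k\<in>\<Lambda>. sqrt ((\<xi> k)\<^sup>2 + (\<Delta> k)\<^sup>2) * (real (N k Up) + real (N k Down)))
          + E_BCS \<Lambda> pos \<xi> \<Delta> \<theta> |
        N :: real ^ 3 \<Rightarrow> spin \<Rightarrow> nat. \<forall>k\<in>\<Lambda>. N k Up \<in> {0, 1} \<and> N k Down \<in> {0, 1}}"
proof -
  let ?E = "\<lambda>k. sqrt ((\<xi> k)\<^sup>2 + (\<Delta> k)\<^sup>2)"
  interpret mean_field \<Lambda> pos \<xi> \<Delta> \<theta> ?E
  proof
    show "bij_betw pos \<Lambda> {..<card \<Lambda>}" by fact
    show "- k \<in> \<Lambda>" if "k \<in> \<Lambda>" for k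
      using that momenta_uminus assms(3) by simp
    show "\<xi> (- k) = \<xi> k" for k
      by (simp add: assms(8) kinetic_def)
    show pos: "0 < ?E k" if "k \<in> \<Lambda>" for k
      using assms(15)[OF that] by simp
    \<comment> \<open>Positivity of the square root allows clearing the denominators in the
      conditions on \<theta>.\<close>
    show "\<Delta> k = ?E k * sin (2 * \<theta> k)" "\<xi> k = ?E k * cos (2 * \<theta> k)" if "k \<in> \<Lambda>" for k
      using assms(18,19)[OF that] pos[OF that] by simp_all
  qed
  have "E_BCS \<Lambda> pos \<xi> \<Delta> \<theta> = E0"
    by (simp add: E_BCS_def E0_def)
  then show ?thesis
    using ground_state_BCS ground_state_unique ground_energy spectrum_H
    by (simp add: level_eq excitation_0)
qed

end
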